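(* Let $\mathbb{K}$ be a field, let $I\subset R=\mathbb{K}[x_1,\ldots,x_n]$ be a monomial ideal generated in degree two, and denote by $u_i$ the maximal degree of a minimal generator in its $i$-th syzygy module. Then, for all $i\geq 0$, $u_{i+1}\leq u_i+2$.
   Context: $I$ is not assumed to be squarefree. For a homogeneous ideal $I$, the graded Betti number $\beta_{i,j}(I)$ is the number of copies of $R(-j)$ in homological degree $i$ in the minimal graded free resolution of $I$ (of the ideal $I$, not of $R/I$); the $0$-th syzygy module is $I$ itself. Thus $u_i=\max\{j:\beta_{i,j}(I)\neq 0\}$. The inequality concerns those $i$ for which the $(i+1)$-th syzygy module is nonzero (equivalently, $u_i=-\infty$ by convention when the $i$-th syzygy module is zero). *)

theory Defs
  imports "HOL-Library.Poly_Mapping" "HOL-Library.Extended_Real"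
begin

(* The polynomial ring K[x_i : i in 'n], with n = CARD('n) variables: finitely supported
   functions from exponent vectors to coefficients. *)

type_synonym ('n, 'k) mpoly = "('n \<Rightarrow>\<^sub>0 nat) \<Rightarrow>\<^sub>0 'k"

definition monomial_degree :: "('n::finite \<Rightarrow>\<^sub>0 nat) \<Rightarrow> nat" where
  "monomial_degree m = (\<Sum>i\<in>UNIV. Poly_Mapping.lookup m i)"

definition monomial :: "('n \<Rightarrow>\<^sub>0 nat) \<Rightarrow> ('n, 'k::comm_ring_1) mpoly" where
  "monomial m = Poly_Mapping.single m 1"

(* The zero polynomial is homogeneous of every degree. *)
definition homogeneous :: "nat \<Rightarrow> ('n::finite, 'k::zero) mpoly \<Rightarrow> bool" where
  "homogeneous e p \<longleftrightarrow> (\<forall>m\<in>Poly_Mapping.keys p. monomial_degree m = e)"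

(* The span of a set in the ring, regarded as a module over itself, is the ideal it generates. *)
definition monomial_ideal_generated_in_degree ::
    "nat \<Rightarrow> ('n::finite, 'k::comm_ring_1) mpoly set \<Rightarrow> bool" where
  "monomial_ideal_generated_in_degree e I \<longleftrightarrow>
     (\<exists>S. (\<forall>m\<in>S. monomial_degree m = e) \<and> I = module.span (*) (monomial ` S))"

(* Free modules of finite rank all live inside the free module "nat =>0 R" of countable rank. *)

definition vscale :: "'r::comm_ring_1 \<Rightarrow> (nat \<Rightarrow>\<^sub>0 'r) \<Rightarrow> (nat \<Rightarrow>\<^sub>0 'r)" where
  "vscale r v = Poly_Mapping.map ((*) r) v"

lemma lookup_vscale: "Poly_Mapping.lookup (vscale r v) k = r * Poly_Mapping.lookup v k"
  by (simp add: vscale_def Poly_Mapping.map.rep_eq when_def)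

lemma module_vscale: "module vscale"
  by unfold_locales (auto intro!: poly_mapping_eqI simp: lookup_vscale lookup_add algebra_simps)

(* A list of shifts a = [a_0, ..., a_{r-1}] encodes the graded free module
   R(-a_0) + ... + R(-a_{r-1}) (direct sum), whose k-th basis element has degree a_k. *)

definition free_module :: "nat list \<Rightarrow> (nat \<Rightarrow>\<^sub>0 ('n, 'k::zero) mpoly) set" where
  "free_module a = {v. Poly_Mapping.keys v \<subseteq> {..<length a}}"

definition graded_piece ::
    "nat list \<Rightarrow> nat \<Rightarrow> (nat \<Rightarrow>\<^sub>0 ('n::finite, 'k::zero) mpoly) set" where
  "graded_piece a e =
     {v \<in> free_module a. \<forall>k<length a. \<forall>m\<in>Poly_Mapping.keys (Poly_Mapping.lookup v k).
        monomial_degree m + a ! k = e}"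

(* The data ... -> F_2 -> F_1 -> F_0 -> R, with F_i = free_module (shifts i),
   aug : F_0 -> R and bdry i : F_{i+1} -> F_i.  The maps are given on the ambient free module of
   countable rank; only their restrictions to the F_i matter (any linear map on F_i extends by
   zero on the remaining basis elements). *)
record (overloaded) ('n, 'k) free_complex =
  shifts :: "nat \<Rightarrow> nat list"
  aug :: "(nat \<Rightarrow>\<^sub>0 ('n, 'k::zero) mpoly) \<Rightarrow> ('n, 'k) mpoly"
  bdry :: "nat \<Rightarrow> (nat \<Rightarrow>\<^sub>0 ('n, 'k) mpoly) \<Rightarrow> (nat \<Rightarrow>\<^sub>0 ('n, 'k) mpoly)"

abbreviation chain_module ::
    "('n, 'k::zero) free_complex \<Rightarrow> nat \<Rightarrow> (nat \<Rightarrow>\<^sub>0 ('n, 'k) mpoly) set" where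
  "chain_module F i \<equiv> free_module (shifts F i)"

(* A resolution of the ideal I itself (not of R/I): F_0 maps onto I.  In the minimality condition,
   the elements of the maximal ideal (x_i : i in 'n) are the polynomials without constant term. *)
locale minimal_graded_free_resolution =
  fixes I :: "('n::finite, 'k::field) mpoly set"
    and F :: "('n, 'k) free_complex"
  assumes aug_linear: "module_hom vscale (*) (aug F)"
    and bdry_linear: "\<And>i. module_hom vscale vscale (bdry F i)"
    and aug_graded: "\<And>e v. v \<in> graded_piece (shifts F 0) e \<Longrightarrow> homogeneous e (aug F v)"
    and bdry_graded: "\<And>i e v. v \<in> graded_piece (shifts F (Suc i)) e \<Longrightarrow>
           bdry F i v \<in> graded_piece (shifts F i) e"
    and aug_onto: "aug F ` chain_module F 0 = I"
    and exact_0: "bdry F 0 ` chain_module F 1 = {v \<in> chain_module F 0. aug F v = 0}"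
    and exact_Suc: "\<And>i. bdry F (Suc i) ` chain_module F (Suc (Suc i)) =
           {v \<in> chain_module F (Suc i). bdry F i v = 0}"
    and minimal: "\<And>i v k. v \<in> chain_module F (Suc i) \<Longrightarrow>
           Poly_Mapping.lookup (Poly_Mapping.lookup (bdry F i v) k) 0 = 0"

(* The number of copies of R(-j) in F_i. *)
definition graded_betti :: "('n, 'k::zero) free_complex \<Rightarrow> nat \<Rightarrow> nat \<Rightarrow> nat" where
  "graded_betti F i j = card {k. k < length (shifts F i) \<and> shifts F i ! k = j}"

(* u_i, with the convention u_i = -\<infinity> when the i-th syzygy module is zero. *)
definition max_syzygy_degree :: "('n, 'k::zero) free_complex \<Rightarrow> nat \<Rightarrow> ereal" where
  "max_syzygy_degree F i =
     (if \<exists>j. graded_betti F i j \<noteq> 0 then ereal (real (Max {j. graded_betti F i j \<noteq> 0}))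
      else -\<infinity>)"

end

theory Submission
  imports Defs
begin

text \<open>
  The generators of \<open>F\<^sub>i\<close> in degree \<open>d\<close> are counted by \<open>Tor\<^sub>i(I, K)\<^sub>d\<close>, which can also be computed as
  the homology of the Koszul complex of \<open>I\<close>. While the resolution is only graded, the Koszul
  complex of a monomial ideal is multigraded: its component at an exponent vector \<open>\<alpha>\<close> is the
  simplicial chain complex of the upper Koszul complex \<open>K\<^sup>\<alpha> = {S. x\<^sup>\<alpha> / x\<^sup>S \<in> I}\<close>.
  The claim thus becomes a statement on simplicial complexes
  (\<open>quadratic_strand_acyclic\<close>): if the homology in position \<open>i\<close> vanishes for all multidegrees of total
  degree at least \<open>t - 2\<close>, then the homology in position \<open>i + 1\<close> vanishes at every \<open>\<alpha>\<close> of
  total degree \<open>t\<close>.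

  To see this, let \<open>x y\<close> be a generator dividing \<open>x\<^sup>\<alpha>\<close>. The faces of \<open>K\<^sup>\<alpha>\<close> that avoid \<open>x\<close> and \<open>y\<close> form
  a full simplex, since \<open>x y\<close> still divides \<open>x\<^sup>\<alpha> / x\<^sup>S\<close> for such \<open>S\<close>. So all homology of \<open>K\<^sup>\<alpha>\<close> in positive
  position comes from the links of \<open>x\<close> and \<open>y\<close>, by the long exact sequences that
  describe the insertion of a vertex (\<open>acyclic_insert\<close>, \<open>acyclic_delete\<close>). The link of a variable is a
  Koszul complex in a multidegree divided by this variable, and two divisions lose only two
  degrees. If a variable has an exponent larger than in all generators, \<open>K\<^sup>\<alpha>\<close> is a cone; a generator
  that is a square is treated like \<open>x y\<close>.

  The comparison of generators with Koszul homology (\<open>generator_degree_iff\<close>) is by dimension shifting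
  along the short exact sequences \<open>0 \<rightarrow> Z\<^sub>i\<^sub>+\<^sub>1 \<rightarrow> F\<^sub>i \<rightarrow> Z\<^sub>i \<rightarrow> 0\<close> of syzygy modules, Koszul complexes of
  free modules being acyclic in positive positions (\<open>koszul_free_acyclic\<close>); the Koszul homology of
  \<open>Z\<^sub>i\<close> in position 0 is \<open>Z\<^sub>i\<close> modulo the maximal ideal, which by minimality has the generators of
  \<open>F\<^sub>i\<close> as a basis.
\<close>

section \<open>Koszul complexes\<close>

text \<open>
  The index type carries no order, but the signs of the Koszul differential need one. Any
  injective numbering of the variables will do.
\<close>

definition ordinal :: "'n::finite \<Rightarrow> nat" where
  "ordinal = (SOME f. inj f)"

lemma inj_ordinal: "inj (ordinal :: 'n::finite \<Rightarrow> nat)"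
proof -
  have "\<exists>f :: 'n \<Rightarrow> nat. inj f"
    using finite_imp_inj_to_nat_seg[of "UNIV :: 'n set"] by auto
  then show ?thesis unfolding ordinal_def by (rule someI_ex)
qed

definition ksign :: "'n::finite \<Rightarrow> 'n set \<Rightarrow> 'a::comm_ring_1" where
  "ksign j S = (- 1) ^ card {s \<in> S. ordinal s < ordinal j}"

lemma ksign_square: "ksign j S * ksign j S = 1"
  by (simp add: ksign_def flip: power_add mult_2)

lemma ksign_cancel: "ksign j S * (ksign j S * a) = a"
  by (simp add: ksign_square flip: mult.assoc)

lemma ksign_cases: "ksign j S = 1 \<or> ksign j S = - 1"
  by (simp add: ksign_def minus_one_power_iff)

lemma ksign_empty [simp]: "ksign j {} = 1"
  by (simp add: ksign_def)

lemma ksign_insert: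
  assumes "l \<notin> S"
  shows "ksign j (insert l S) = (if ordinal l < ordinal j then - ksign j S else ksign j S)"
proof (cases "ordinal l < ordinal j")
  case True
  then have "{s \<in> insert l S. ordinal s < ordinal j} = insert l {s \<in> S. ordinal s < ordinal j}"
    by auto
  with True assms show ?thesis by (simp add: ksign_def)
next
  case False
  then have "{s \<in> insert l S. ordinal s < ordinal j} = {s \<in> S. ordinal s < ordinal j}"
    by auto
  with False show ?thesis by (simp add: ksign_def)
qed

text \<open>
  This identity is everything the signs have to satisfy: it makes the square of the differential
  vanish, and it lets an \<^emph>\<open>arbitrary\<close> variable, not only the largest one, be split off.
\<close>

lemma ksign_swap:
  assumes "j \<noteq> l" "j \<notin> S" "l \<notin> S"
  shows "ksign j S * ksign l (insert j S) = - (ksign l S * ksign j (insert l S))"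
proof -
  have "ordinal j \<noteq> ordinal l" using assms(1) inj_ordinal by (auto dest: injD)
  then show ?thesis
    using assms by (auto simp: ksign_insert not_less mult.commute)
qed

text \<open>
  A chain assigns a coefficient to each set of variables, \<open>c S\<close> being the coefficient of the
  exterior monomial \<open>e\<^sub>S\<close>. If \<open>X j\<close> is multiplication by the variable \<open>x\<^sub>j\<close>, this is the Koszul
  differential; if all \<open>X j\<close> equal 1, it is a simplicial boundary map. Coefficients live in a ring
  because all modules that occur are subsets of one, so that variables, signs and scalars
  multiply in the same way.
\<close>

definition koszul :: "('n::finite \<Rightarrow> 'a::comm_ring_1) \<Rightarrow> 'n set \<Rightarrow> ('n set \<Rightarrow> 'a) \<Rightarrow> 'n set \<Rightarrow> 'a"
  where "koszul X T c S = (\<Sum>j\<in>T - S. ksign j S * X j * c (insert j S))"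

text \<open>
  The coefficient of \<open>e\<^sub>S\<close> is restricted by a set \<open>M S\<close> depending on \<open>S\<close>. A graded strand
  is obtained by letting \<open>M S\<close> contain elements of degree \<open>d - card S\<close>, and a simplicial complex
  by letting \<open>M S\<close> be everything if \<open>S\<close> is a face and zero otherwise.
\<close>

definition chains :: "'n::finite set \<Rightarrow> nat \<Rightarrow> ('n set \<Rightarrow> 'a::comm_ring_1 set) \<Rightarrow> ('n set \<Rightarrow> 'a) set"
  where "chains T p M = {c. \<forall>S. if S \<subseteq> T \<and> card S = p then c S \<in> M S else c S = 0}"

definition acyclic_at ::
    "('n::finite \<Rightarrow> 'a::comm_ring_1) \<Rightarrow> 'n set \<Rightarrow> nat \<Rightarrow> ('n set \<Rightarrow> 'a set) \<Rightarrow> bool" where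
  "acyclic_at X T p M \<longleftrightarrow>
     (\<forall>c\<in>chains T p M. (\<forall>S. koszul X T c S = 0) \<longrightarrow>
        (\<exists>b\<in>chains T (Suc p) M. \<forall>S. koszul X T b S = c S))"

definition koszul_stable :: "('n::finite \<Rightarrow> 'a::comm_ring_1) \<Rightarrow> ('n set \<Rightarrow> 'a set) \<Rightarrow> bool" where
  "koszul_stable X M \<longleftrightarrow>
     (\<forall>S. 0 \<in> M S \<and> (\<forall>u\<in>M S. - u \<in> M S \<and> (\<forall>v\<in>M S. u + v \<in> M S)) \<and>
        (\<forall>j. j \<notin> S \<longrightarrow> (\<forall>v\<in>M (insert j S). X j * v \<in> M S)))"

lemma koszul_stableI:
  assumes "\<And>S. 0 \<in> M S" "\<And>S u. u \<in> M S \<Longrightarrow> - u \<in> M S"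
    "\<And>S u v. u \<in> M S \<Longrightarrow> v \<in> M S \<Longrightarrow> u + v \<in> M S"
    "\<And>S j v. j \<notin> S \<Longrightarrow> v \<in> M (insert j S) \<Longrightarrow> X j * v \<in> M S"
  shows "koszul_stable X M"
  using assms unfolding koszul_stable_def by blast

lemma koszul_stableD:
  assumes "koszul_stable X M"
  shows koszul_stable_zero: "0 \<in> M S"
    and koszul_stable_minus: "u \<in> M S \<Longrightarrow> - u \<in> M S"
    and koszul_stable_add: "u \<in> M S \<Longrightarrow> v \<in> M S \<Longrightarrow> u + v \<in> M S"
    and koszul_stable_act: "j \<notin> S \<Longrightarrow> v \<in> M (insert j S) \<Longrightarrow> X j * v \<in> M S"
  using assms unfolding koszul_stable_def by blast+

lemma koszul_stable_sign:
  assumes "koszul_stable X M" "u \<in> M S"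
  shows "ksign j U * u \<in> M S"
proof -
  have "ksign j U * u = u \<or> ksign j U * u = - u"
    using ksign_cases[of j U] by (metis mult_1 mult_minus1)
  then show ?thesis using assms koszul_stable_minus by metis
qed

lemma koszul_stable_sum:
  assumes "koszul_stable X M" "\<And>a. a \<in> A \<Longrightarrow> f a \<in> M S"
  shows "sum f A \<in> M S"
  using assms(2)
  by (induction A rule: infinite_finite_induct)
     (auto intro: koszul_stable_zero[OF assms(1)] koszul_stable_add[OF assms(1)])

lemma chainsI:
  assumes "\<And>S. S \<subseteq> T \<Longrightarrow> card S = p \<Longrightarrow> c S \<in> M S"
    "\<And>S. \<not> (S \<subseteq> T \<and> card S = p) \<Longrightarrow> c S = 0"
  shows "c \<in> chains T p M"
  using assms by (simp add: chains_def)

lemma chains_mem: "c \<in> chains T p M \<Longrightarrow> S \<subseteq> T \<Longrightarrow> card S = p \<Longrightarrow> c S \<in> M S"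
  by (simp add: chains_def)

lemma chains_zero: "c \<in> chains T p M \<Longrightarrow> \<not> (S \<subseteq> T \<and> card S = p) \<Longrightarrow> c S = 0"
  unfolding chains_def mem_Collect_eq by (drule spec[of _ S]) (simp only: if_False)

lemma chains_in_stable: "koszul_stable X M \<Longrightarrow> c \<in> chains T p M \<Longrightarrow> c S \<in> M S"
  by (metis chains_mem chains_zero koszul_stable_zero)

lemma acyclic_atD:
  assumes "acyclic_at X T p M" "c \<in> chains T p M" "\<And>S. koszul X T c S = 0"
  obtains b where "b \<in> chains T (Suc p) M" "\<And>S. koszul X T b S = c S"
  using assms unfolding acyclic_at_def by blast

lemma acyclic_at_cong:
  assumes "\<And>S. S \<subseteq> T \<Longrightarrow> card S \<in> {p, Suc p} \<Longrightarrow> M S = N S"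
  shows "acyclic_at X T p M = acyclic_at X T p N"
proof -
  have "chains T p M = chains T p N" "chains T (Suc p) M = chains T (Suc p) N"
    using assms by (auto simp: chains_def)
  then show ?thesis by (simp add: acyclic_at_def)
qed

lemma koszul_diff: "koszul X T (\<lambda>S. a S - b S) S = koszul X T a S - koszul X T b S"
  by (simp add: koszul_def sum_subtractf algebra_simps)

lemma koszul_add: "koszul X T (\<lambda>S. a S + b S) S = koszul X T a S + koszul X T b S"
  by (simp add: koszul_def sum.distrib algebra_simps)

lemma koszul_mult: "koszul X T (\<lambda>S. r * a S) S = r * koszul X T a S"
  by (simp add: koszul_def sum_distrib_left algebra_simps)

lemma koszul_zero [simp]: "koszul X T (\<lambda>S. 0) S = 0"
  by (simp add: koszul_def)

lemma koszul_cong: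
  "(\<And>j. j \<in> T - S \<Longrightarrow> a (insert j S) = b (insert j S)) \<Longrightarrow> koszul X T a S = koszul X T b S"
  unfolding koszul_def by (rule sum.cong) auto

lemma koszul_in_chains:
  assumes "koszul_stable X M" "c \<in> chains T (Suc p) M"
  shows "koszul X T c \<in> chains T p M"
proof (rule chainsI)
  fix S assume "S \<subseteq> T" "card S = p"
  show "koszul X T c S \<in> M S"
    unfolding koszul_def mult.assoc
  proof (rule koszul_stable_sum[OF assms(1)])
    fix j assume "j \<in> T - S"
    then show "ksign j S * (X j * c (insert j S)) \<in> M S"
      using assms chains_in_stable[OF assms]
      by (auto intro!: koszul_stable_sign[OF assms(1)] koszul_stable_act[OF assms(1)])
  qed
next
  fix S assume *: "\<not> (S \<subseteq> T \<and> card S = p)"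
  have "c (insert j S) = 0" if "j \<in> T - S" for j
    by (rule chains_zero[OF assms(2)]) (use * that in auto)
  then show "koszul X T c S = 0" by (simp add: koszul_def)
qed

lemma koszul_insert_base:
  assumes "x \<notin> S" "x \<notin> T"
  shows "koszul X (insert x T) c S = koszul X T c S + X x * (ksign x S * c (insert x S))"
proof -
  have "insert x T - S = insert x (T - S)" using assms by auto
  with assms show ?thesis by (simp add: koszul_def algebra_simps)
qed

lemma koszul_insert_link:
  assumes "x \<notin> S" "x \<notin> T"
  shows "ksign x S * koszul X (insert x T) c (insert x S)
           = - koszul X T (\<lambda>U. ksign x U * c (insert x U)) S"
proof -
  have *: "insert x T - insert x S = T - S" using assms by auto
  show ?thesis
    unfolding koszul_def * sum_distrib_left sum_negf[symmetric]
  proof (rule sum.cong[OF refl])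
    fix j assume j: "j \<in> T - S"
    then have "x \<noteq> j" "j \<notin> S" using assms by auto
    then have "ksign x S * ksign j (insert x S) = - (ksign j S * ksign x (insert j S) :: 'b)"
      using ksign_swap[of x j S] assms by simp
    then have "ksign x S * ksign j (insert x S) * (X j * c (insert j (insert x S)))
       = - (ksign j S * ksign x (insert j S)) * (X j * c (insert j (insert x S)))" by simp
    then show "ksign x S * (ksign j (insert x S) * X j * c (insert j (insert x S)))
       = - (ksign j S * X j * (ksign x (insert j S) * c (insert x (insert j S))))"
      by (simp add: algebra_simps insert_commute)
  qed
qed

text \<open>
  Induction on the set of variables: splitting off \<open>x\<close> turns a chain into a pair \<open>(a, b)\<close> with
  differential \<open>(\<partial> a + X\<^sub>x b, - \<partial> b)\<close>, whose square vanishes as soon as that of \<open>\<partial>\<close> does.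
\<close>

lemma koszul_koszul:
  fixes X :: "'n::finite \<Rightarrow> 'a::comm_ring_1"
  shows "koszul X T (koszul X T c) S = 0"
proof -
  have "finite T" by simp
  then have "\<forall>S c. koszul X T (koszul X T c) S = 0"
  proof (induction T)
    case (empty)
    show ?case by (simp add: koszul_def)
  next
    case (insert x T)
    have link: "ksign x S * koszul X (insert x T) c (insert x S)
           = - koszul X T (\<lambda>U. ksign x U * c (insert x U)) S" if "x \<notin> S" for S c
      using koszul_insert_link that insert(2) by metis
    have notin: "x \<notin> insert j S" if "x \<notin> S" "j \<in> T - S" for j S
      using that insert(2) by auto
    show ?case
    proof (intro allI)
      fix S and c :: "'n set \<Rightarrow> 'a"
      let ?b = "\<lambda>U. ksign x U * c (insert x U)"
      have base: "koszul X (insert x T) (koszul X (insert x T) c) S = 0" if x: "x \<notin> S" for S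
      proof -
        have "koszul X T (koszul X (insert x T) c) S
            = koszul X T (\<lambda>U. koszul X T c U - - (X x * ?b U)) S"
          by (rule koszul_cong) (use notin[OF x] insert(2) in \<open>simp add: koszul_insert_base\<close>)
        also have "\<dots> = X x * koszul X T ?b S"
          unfolding koszul_diff using insert(3)
          by (simp add: koszul_mult[of X T "- X x", simplified])
        finally show ?thesis
          by (simp add: koszul_insert_base[OF x insert(2)] link[OF x])
      qed
      have "koszul X (insert x T) (koszul X (insert x T) c) (insert x S) = 0" if x: "x \<notin> S" for S
      proof -
        have "ksign x S * koszul X (insert x T) (koszul X (insert x T) c) (insert x S)
          = - koszul X T (\<lambda>U. - 1 * koszul X T ?b U) S"
          unfolding link[OF x]
          by (rule arg_cong[where f=uminus], rule koszul_cong) (simp add: link[OF notin[OF x]])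
        also have "\<dots> = 0" unfolding koszul_mult using insert(3) by simp
        finally show ?thesis by (metis ksign_cancel mult_zero_right)
      qed
      with base show "koszul X (insert x T) (koszul X (insert x T) c) S = 0"
        by (cases "x \<in> S") (metis Set.set_insert, blast)
    qed
  qed
  then show ?thesis by blast
qed

section \<open>Splitting off a variable\<close>

text \<open>
  The chain with component \<open>a\<close> on the sets without \<open>x\<close> and component \<open>b\<close> on the link of \<open>x\<close>; the
  sign makes the differential of the pair \<open>(a, b)\<close> equal to \<open>(\<partial> a + X\<^sub>x b, - \<partial> b)\<close>. The parts defined
  below are its inverse.
\<close>

definition glue :: "'n::finite \<Rightarrow> ('n set \<Rightarrow> 'a::comm_ring_1) \<Rightarrow> ('n set \<Rightarrow> 'a) \<Rightarrow> 'n set \<Rightarrow> 'a" where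
  "glue x a b S = (if x \<in> S then ksign x (S - {x}) * b (S - {x}) else a S)"

lemma glue_base: "x \<notin> S \<Longrightarrow> glue x a b S = a S"
  and glue_link: "x \<notin> S \<Longrightarrow> glue x a b (insert x S) = ksign x S * b S"
  by (auto simp: glue_def)

lemma koszul_glue_base:
  assumes "x \<notin> S" "x \<notin> T"
  shows "koszul X (insert x T) (glue x a b) S = koszul X T a S + X x * b S"
proof -
  have "koszul X T (glue x a b) S = koszul X T a S"
    by (rule koszul_cong, rule glue_base) (use assms in auto)
  then show ?thesis by (simp add: koszul_insert_base assms glue_link ksign_cancel)
qed

lemma koszul_glue_link:
  assumes "x \<notin> S" "x \<notin> T"
  shows "koszul X (insert x T) (glue x a b) (insert x S) = - (ksign x S * koszul X T b S)"
proof -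
  have "ksign x S * koszul X (insert x T) (glue x a b) (insert x S) = - koszul X T b S"
    unfolding koszul_insert_link[OF assms]
  proof (rule arg_cong[where f=uminus], rule koszul_cong)
    fix j assume "j \<in> T - S"
    then have "x \<notin> insert j S" using assms by auto
    then show "ksign x (insert j S) * glue x a b (insert x (insert j S)) = b (insert j S)"
      by (simp add: glue_link ksign_cancel)
  qed
  then show ?thesis by (metis ksign_cancel mult_minus_right)
qed

lemma glue_in_chains:
  assumes M: "koszul_stable X M" and x: "x \<notin> T"
    and a: "a \<in> chains T (Suc p) M" and b: "b \<in> chains T p (\<lambda>S. M (insert x S))"
  shows "glue x a b \<in> chains (insert x T) (Suc p) M"
proof (rule chainsI)
  fix S assume S: "S \<subseteq> insert x T" "card S = Suc p"
  show "glue x a b S \<in> M S"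
  proof (cases "x \<in> S")
    case True
    then obtain U where U: "S = insert x U" "x \<notin> U" by (meson Set.set_insert)
    with S x have "U \<subseteq> T" "card U = p" by auto
    then show ?thesis
      using U chains_mem[OF b] by (auto simp: glue_link intro: koszul_stable_sign[OF M])
  next
    case False
    with S show ?thesis by (auto simp: glue_base intro: chains_mem[OF a])
  qed
next
  fix S assume S: "\<not> (S \<subseteq> insert x T \<and> card S = Suc p)"
  show "glue x a b S = 0"
  proof (cases "x \<in> S")
    case True
    then obtain U where U: "S = insert x U" "x \<notin> U" by (meson Set.set_insert)
    with S have "\<not> (U \<subseteq> T \<and> card U = p)" by auto
    with U show ?thesis by (simp add: glue_link chains_zero[OF b])
  next
    case False
    with S x have "\<not> (S \<subseteq> T \<and> card S = Suc p)" by auto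
    with False show ?thesis by (simp add: glue_base chains_zero[OF a])
  qed
qed

definition base_part :: "'n::finite \<Rightarrow> ('n set \<Rightarrow> 'a::comm_ring_1) \<Rightarrow> 'n set \<Rightarrow> 'a" where
  "base_part x c S = (if x \<in> S then 0 else c S)"

definition link_part :: "'n::finite \<Rightarrow> ('n set \<Rightarrow> 'a::comm_ring_1) \<Rightarrow> 'n set \<Rightarrow> 'a" where
  "link_part x c S = (if x \<in> S then 0 else ksign x S * c (insert x S))"

lemma glue_parts: "glue x (base_part x c) (link_part x c) = c"
  by (rule ext) (auto simp: glue_def base_part_def link_part_def ksign_cancel insert_absorb)

lemma base_part_in_chains:
  assumes "x \<notin> T" "c \<in> chains (insert x T) p M"
  shows "base_part x c \<in> chains T p M"
proof (rule chainsI)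
  fix S assume S: "S \<subseteq> T" "card S = p"
  then have "x \<notin> S" "S \<subseteq> insert x T" using assms(1) by auto
  with S show "base_part x c S \<in> M S"
    by (simp add: base_part_def chains_mem[OF assms(2)])
next
  fix S assume "\<not> (S \<subseteq> T \<and> card S = p)"
  then show "base_part x c S = 0"
    by (auto simp: base_part_def intro!: chains_zero[OF assms(2)])
qed

lemma link_part_in_chains:
  assumes "koszul_stable X M" "x \<notin> T" "c \<in> chains (insert x T) (Suc p) M"
  shows "link_part x c \<in> chains T p (\<lambda>S. M (insert x S))"
proof (rule chainsI)
  fix S assume "S \<subseteq> T" "card S = p"
  moreover from this assms(2) have "x \<notin> S" by auto
  ultimately show "link_part x c S \<in> M (insert x S)"
    by (auto simp: link_part_def intro!: koszul_stable_sign[OF assms(1)] chains_mem[OF assms(3)])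
next
  fix S assume "\<not> (S \<subseteq> T \<and> card S = p)"
  then have "x \<notin> S \<Longrightarrow> c (insert x S) = 0"
    by (intro chains_zero[OF assms(3)]) auto
  then show "link_part x c S = 0" by (simp add: link_part_def)
qed

lemma koszul_parts:
  assumes "x \<notin> S" "x \<notin> T"
  shows "koszul X (insert x T) c S = koszul X T (base_part x c) S + X x * link_part x c S"
    and "koszul X (insert x T) c (insert x S) = - (ksign x S * koszul X T (link_part x c) S)"
  using koszul_glue_base[OF assms] koszul_glue_link[OF assms] glue_parts by metis+

lemma koszul_outside:
  assumes "c \<in> chains T p M" "\<not> S \<subseteq> T"
  shows "koszul X T c S = 0"
proof -
  have "c (insert j S) = 0" for j
    using assms by (intro chains_zero[OF assms(1)]) auto
  then show ?thesis by (simp add: koszul_def)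
qed

lemma link_part_cycle:
  assumes M: "koszul_stable X M" and x: "x \<notin> T" and c: "c \<in> chains (insert x T) (Suc p) M"
    and zero: "\<And>S. x \<notin> S \<Longrightarrow> koszul X (insert x T) c (insert x S) = 0"
  shows "koszul X T (link_part x c) S = 0"
proof (cases "x \<in> S")
  case True
  then show ?thesis using koszul_outside[OF link_part_in_chains[OF M x c]] x by auto
next
  case False
  then have "ksign x S * koszul X T (link_part x c) S = 0"
    using koszul_parts(2)[OF False x, of X c] zero by simp
  then show ?thesis by (metis ksign_cancel mult_zero_right)
qed

lemma add_act_in_chains:
  assumes M: "koszul_stable X M" and x: "x \<notin> T"
    and a: "a \<in> chains T p M" and b: "b \<in> chains T p (\<lambda>S. M (insert x S))"
  shows "(\<lambda>S. a S + X x * b S) \<in> chains T p M"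
proof (rule chainsI)
  fix S assume S: "S \<subseteq> T" "card S = p"
  then have "x \<notin> S" using x by auto
  then show "a S + X x * b S \<in> M S"
    using chains_mem[OF a S] chains_mem[OF b S]
    by (auto intro: koszul_stable_add[OF M] koszul_stable_act[OF M])
next
  fix S assume S: "\<not> (S \<subseteq> T \<and> card S = p)"
  show "a S + X x * b S = 0" using chains_zero[OF a S] chains_zero[OF b S] by simp
qed

text \<open>
  The chains over \<open>T \<union> {x}\<close> are an extension of the chains on the link of \<open>x\<close> by the chains over
  \<open>T\<close>. In the long exact sequence
  \<open>H\<^sub>p\<^sub>+\<^sub>1(T; M) \<rightarrow> H\<^sub>p\<^sub>+\<^sub>1(T \<union> {x}; M) \<rightarrow> H\<^sub>p(T; link) \<rightarrow> H\<^sub>p(T; M) \<rightarrow> H\<^sub>p(T \<union> {x}; M)\<close>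
  the middle of the first three terms vanishes together with its neighbours.
\<close>

lemma acyclic_insert:
  assumes M: "koszul_stable X M" and x: "x \<notin> T"
    and base: "acyclic_at X T (Suc p) M"
    and link: "acyclic_at X T p (\<lambda>S. M (insert x S))"
  shows "acyclic_at X (insert x T) (Suc p) M"
  unfolding acyclic_at_def
proof (intro ballI impI)
  fix c assume c: "c \<in> chains (insert x T) (Suc p) M"
    and cyc: "\<forall>S. koszul X (insert x T) c S = 0"
  let ?a = "base_part x c" and ?b = "link_part x c"
  have "koszul X T ?b S = 0" for S by (rule link_part_cycle[OF M x c]) (simp add: cyc)
  then obtain b' where b': "b' \<in> chains T (Suc p) (\<lambda>S. M (insert x S))"
    and bb': "\<And>S. koszul X T b' S = ?b S"
    by (rule acyclic_atD[OF link link_part_in_chains[OF M x c]]) blast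
  let ?e = "\<lambda>S. ?a S + X x * b' S"
  have e: "?e \<in> chains T (Suc p) M"
    by (rule add_act_in_chains[OF M x base_part_in_chains[OF x c] b'])
  have "koszul X T ?e S = 0" for S
  proof (cases "x \<in> S")
    case True
    then show ?thesis using koszul_outside[OF e] x by auto
  next
    case False
    then show ?thesis
      using koszul_parts(1)[OF False x, of X c] cyc by (simp add: koszul_add koszul_mult bb')
  qed
  then obtain e' where e': "e' \<in> chains T (Suc (Suc p)) M"
    and ee': "\<And>S. koszul X T e' S = ?e S"
    by (rule acyclic_atD[OF base e]) blast
  let ?d = "glue x e' (\<lambda>S. - b' S)"
  have "(\<lambda>S. - b' S) \<in> chains T (Suc p) (\<lambda>S. M (insert x S))"
    by (rule chainsI) (auto simp: chains_zero[OF b'] intro!: koszul_stable_minus[OF M] chains_mem[OF b'])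
  then have "?d \<in> chains (insert x T) (Suc (Suc p)) M"
    by (rule glue_in_chains[OF M x e'])
  moreover have "koszul X (insert x T) ?d S = c S" for S
  proof (cases "x \<in> S")
    case False
    then show ?thesis
      by (simp add: koszul_glue_base x ee') (simp add: base_part_def)
  next
    case True
    then obtain U where U: "S = insert x U" "x \<notin> U" by (meson Set.set_insert)
    have "koszul X T (\<lambda>S. - b' S) U = - ?b U"
      using koszul_mult[of X T "- 1" b' U] by (simp add: bb')
    then show ?thesis
      by (simp add: U koszul_glue_link x) (simp add: link_part_def U ksign_cancel)
  qed
  ultimately show "\<exists>d\<in>chains (insert x T) (Suc (Suc p)) M. \<forall>S. koszul X (insert x T) d S = c S"
    by blast
qed

text \<open>
  The same long exact sequence, read at its last three terms: \<open>H\<^sub>p(T; M)\<close> lies between the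
  homology of the link and that over \<open>T \<union> {x}\<close>.
\<close>

lemma acyclic_delete:
  assumes M: "koszul_stable X M" and x: "x \<notin> T"
    and all: "acyclic_at X (insert x T) p M"
    and link: "acyclic_at X T p (\<lambda>S. M (insert x S))"
  shows "acyclic_at X T p M"
  unfolding acyclic_at_def
proof (intro ballI impI)
  fix c assume c: "c \<in> chains T p M" and cyc: "\<forall>S. koszul X T c S = 0"
  have out: "c S = 0" if "x \<in> S" for S
    using that x by (intro chains_zero[OF c]) auto
  have "c \<in> chains (insert x T) p M"
  proof (rule chainsI)
    fix S assume "S \<subseteq> insert x T" "card S = p"
    then show "c S \<in> M S"
      using chains_in_stable[OF M c] by simp
  next
    fix S assume "\<not> (S \<subseteq> insert x T \<and> card S = p)"
    then show "c S = 0" by (intro chains_zero[OF c]) auto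
  qed
  moreover have "koszul X (insert x T) c S = 0" for S
  proof (cases "x \<in> S")
    case True
    then show ?thesis by (simp add: koszul_def out)
  next
    case False
    then show ?thesis by (simp add: koszul_insert_base x out cyc)
  qed
  ultimately obtain d where d: "d \<in> chains (insert x T) (Suc p) M"
    and dc: "\<And>S. koszul X (insert x T) d S = c S"
    by (rule acyclic_atD[OF all]) blast
  let ?a = "base_part x d" and ?b = "link_part x d"
  have "koszul X T ?b S = 0" for S by (rule link_part_cycle[OF M x d]) (simp add: dc out)
  then obtain b' where b': "b' \<in> chains T (Suc p) (\<lambda>S. M (insert x S))"
    and bb': "\<And>S. koszul X T b' S = ?b S"
    by (rule acyclic_atD[OF link link_part_in_chains[OF M x d]]) blast
  let ?e = "\<lambda>S. ?a S + X x * b' S"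
  have e: "?e \<in> chains T (Suc p) M"
    by (rule add_act_in_chains[OF M x base_part_in_chains[OF x d] b'])
  moreover have "koszul X T ?e S = c S" for S
  proof (cases "x \<in> S")
    case True
    then show ?thesis using koszul_outside[OF e] out x by auto
  next
    case False
    then show ?thesis
      using koszul_parts(1)[OF False x, of X d] dc by (simp add: koszul_add koszul_mult bb')
  qed
  ultimately show "\<exists>e\<in>chains T (Suc p) M. \<forall>S. koszul X T e S = c S" by blast
qed

text \<open>
  If every face stays a face after adding \<open>x\<close>, the complex is a cone with apex \<open>x\<close>: a cycle is the
  boundary of the join of \<open>x\<close> with its part avoiding \<open>x\<close>.
\<close>

lemma acyclic_cone:
  assumes M: "koszul_stable (\<lambda>_. 1) M" and x: "x \<notin> T"
    and cone: "\<And>S. S \<subseteq> T \<Longrightarrow> M S \<subseteq> M (insert x S)"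
  shows "acyclic_at (\<lambda>_. 1) (insert x T) p M"
  unfolding acyclic_at_def
proof (intro ballI impI)
  fix c assume c: "c \<in> chains (insert x T) p M"
    and cyc: "\<forall>S. koszul (\<lambda>_. 1) (insert x T) c S = 0"
  let ?a = "base_part x c" and ?b = "link_part x c"
  have a: "?a \<in> chains T p M" using base_part_in_chains[OF x c] .
  have "?a \<in> chains T p (\<lambda>S. M (insert x S))"
    using cone chains_mem[OF a] by (intro chainsI) (blast, rule chains_zero[OF a])
  moreover have "(\<lambda>_. 0) \<in> chains T (Suc p) M"
    by (rule chainsI) (auto intro: koszul_stable_zero[OF M])
  ultimately have "glue x (\<lambda>_. 0) ?a \<in> chains (insert x T) (Suc p) M"
    using glue_in_chains[OF M x] by blast
  moreover have "koszul (\<lambda>_. 1) (insert x T) (glue x (\<lambda>_. 0) ?a) S = c S" for S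
  proof (cases "x \<in> S")
    case False
    then show ?thesis by (simp add: koszul_glue_base x base_part_def)
  next
    case True
    then obtain U where U: "S = insert x U" "x \<notin> U" by (meson Set.set_insert)
    have "koszul (\<lambda>_. 1) T ?a U = - ?b U"
      using koszul_parts(1)[OF U(2) x, of "\<lambda>_. 1" c] cyc by (simp add: add_eq_0_iff2)
    then show ?thesis
      by (simp add: U koszul_glue_link x) (simp add: link_part_def U ksign_cancel)
  qed
  ultimately show "\<exists>d\<in>chains (insert x T) (Suc p) M. \<forall>S. koszul (\<lambda>_. 1) (insert x T) d S = c S"
    by blast
qed

lemma acyclic_at_trivial:
  assumes "\<And>S. S \<subseteq> T \<Longrightarrow> card S = p \<Longrightarrow> M S \<subseteq> {0}" "\<And>S. 0 \<in> M S"
  shows "acyclic_at X T p M"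
  unfolding acyclic_at_def
proof (intro ballI impI)
  fix c assume c: "c \<in> chains T p M"
  have "c S = 0" for S
    using chains_mem[OF c, of S] chains_zero[OF c, of S] assms(1)[of S] by blast
  moreover have "(\<lambda>_. 0) \<in> chains T (Suc p) M"
    by (rule chainsI) (auto intro: assms(2))
  ultimately show "\<exists>b\<in>chains T (Suc p) M. \<forall>S. koszul X T b S = c S"
    by (intro bexI[of _ "\<lambda>_. 0"]) auto
qed

section \<open>Strands of fixed multidegree\<close>

lemma monomial_degree_add: "monomial_degree (m + n) = monomial_degree m + monomial_degree n"
  by (simp add: monomial_degree_def lookup_add sum.distrib)

lemma monomial_degree_single: "monomial_degree (Poly_Mapping.single x r) = r"
  by (simp add: monomial_degree_def lookup_single when_def)

lemma monomial_degree_zero: "monomial_degree 0 = 0"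
  by (simp add: monomial_degree_def)

lemma monomial_degree_eq_0_iff: "monomial_degree m = 0 \<longleftrightarrow> m = 0"
  by (auto simp: monomial_degree_def intro: poly_mapping_eqI)

lemma exponent_minus_plus:
  fixes m n :: "'n \<Rightarrow>\<^sub>0 nat"
  assumes "\<And>x. Poly_Mapping.lookup n x \<le> Poly_Mapping.lookup m x"
  shows "m - n + n = m"
  by (rule poly_mapping_eqI) (simp add: lookup_add lookup_minus assms)

lemma monomial_degree_minus_single:
  assumes "r \<le> Poly_Mapping.lookup m x"
  shows "monomial_degree (m - Poly_Mapping.single x r) + r = monomial_degree m"
proof -
  have "m - Poly_Mapping.single x r + Poly_Mapping.single x r = m"
    by (rule exponent_minus_plus) (use assms in \<open>auto simp: lookup_single when_def\<close>)
  then show ?thesis using monomial_degree_add monomial_degree_single by metis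
qed

text \<open>
  The exponent vector of the squarefree monomial \<open>x\<^sup>S\<close>, the multidegree of \<open>e\<^sub>S\<close>.
\<close>

definition ind :: "'n::finite set \<Rightarrow> 'n \<Rightarrow>\<^sub>0 nat" where
  "ind S = (\<Sum>j\<in>S. Poly_Mapping.single j 1)"

lemma lookup_ind: "Poly_Mapping.lookup (ind S) j = (if j \<in> S then 1 else 0)"
  by (simp add: ind_def lookup_sum lookup_single when_def)

lemma ind_insert: "x \<notin> S \<Longrightarrow> ind (insert x S) = Poly_Mapping.single x 1 + ind S"
  by (simp add: ind_def)

lemma ind_empty [simp]: "ind {} = 0"
  by (simp add: ind_def)

lemma monomial_degree_ind: "monomial_degree (ind S) = card S"
  by (simp add: monomial_degree_def lookup_ind flip: sum.inter_filter)

lemma minus_ind_plus_ind: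
  assumes "S \<subseteq> Poly_Mapping.keys \<alpha>"
  shows "\<alpha> - ind S + ind S = \<alpha>"
  by (rule exponent_minus_plus)
     (use assms in \<open>auto simp: lookup_ind in_keys_iff Suc_le_eq\<close>)

text \<open>
  In multidegree \<open>\<alpha>\<close>, the coefficient of \<open>e\<^sub>S\<close> is a multiple of the one monomial \<open>x\<^sup>\<alpha> / x\<^sup>S\<close>, so it is
  a scalar, present if that monomial exists and is admitted by \<open>Q\<close>. For an ideal the sets
  \<open>S\<close> with this property form its upper Koszul simplicial complex at \<open>\<alpha>\<close>.
\<close>

definition strand ::
    "(('n::finite \<Rightarrow>\<^sub>0 nat) \<Rightarrow> 'n set \<Rightarrow> bool) \<Rightarrow> ('n \<Rightarrow>\<^sub>0 nat) \<Rightarrow> 'n set \<Rightarrow> 'a::zero set" where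
  "strand Q \<alpha> S = {v. v = 0 \<or> S \<subseteq> Poly_Mapping.keys \<alpha> \<and> Q (\<alpha> - ind S) S}"

definition shift_closed :: "(('n::finite \<Rightarrow>\<^sub>0 nat) \<Rightarrow> 'n set \<Rightarrow> bool) \<Rightarrow> bool" where
  "shift_closed Q \<longleftrightarrow>
     (\<forall>m S j. j \<notin> S \<longrightarrow> Q m (insert j S) \<longrightarrow> Q (m + Poly_Mapping.single j 1) S)"

lemma minus_ind_insert:
  assumes "j \<notin> S" "j \<in> Poly_Mapping.keys \<alpha>"
  shows "\<alpha> - ind (insert j S) + Poly_Mapping.single j 1 = \<alpha> - ind S"
  by (rule poly_mapping_eqI)
     (use assms in \<open>auto simp: lookup_add lookup_minus lookup_ind lookup_single when_def in_keys_iff\<close>)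

lemma strand_stable:
  assumes "shift_closed Q"
  shows "koszul_stable (\<lambda>_. 1) (strand Q \<alpha>)"
proof (rule koszul_stableI)
  fix S j and v :: 'b
  assume j: "j \<notin> S" and v: "v \<in> strand Q \<alpha> (insert j S)"
  show "1 * v \<in> strand Q \<alpha> S"
  proof (cases "v = 0")
    case False
    with v have *: "S \<subseteq> Poly_Mapping.keys \<alpha>" "j \<in> Poly_Mapping.keys \<alpha>" "Q (\<alpha> - ind (insert j S)) (insert j S)"
      by (auto simp: strand_def)
    with assms j have "Q (\<alpha> - ind S) S"
      unfolding shift_closed_def by (metis minus_ind_insert)
    with * show ?thesis by (simp add: strand_def)
  qed (simp add: strand_def)
qed (auto simp: strand_def)

text \<open>
  All subsets of \<open>T\<close> that lie in the support of \<open>\<alpha>\<close> are present, so the complex is a full simplex,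
  which is a cone unless it is empty; in that case it only has the empty face, which is seen in
  position 0 alone.
\<close>

lemma strand_full_acyclic:
  assumes Q: "shift_closed Q" and p: "0 < p \<or> T \<inter> Poly_Mapping.keys \<alpha> \<noteq> {}"
    and full: "\<And>S. S \<subseteq> T \<Longrightarrow> S \<subseteq> Poly_Mapping.keys \<alpha> \<Longrightarrow> Q (\<alpha> - ind S) S"
  shows "acyclic_at (\<lambda>_. 1) T p (strand Q \<alpha> :: _ \<Rightarrow> 'a::comm_ring_1 set)"
proof (cases "T \<inter> Poly_Mapping.keys \<alpha> = {}")
  case True
  show ?thesis
  proof (rule acyclic_at_trivial)
    fix S assume S: "S \<subseteq> T" "card S = p"
    with True p have "S \<noteq> {}" "S \<inter> Poly_Mapping.keys \<alpha> = {}" by auto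
    then have "\<not> S \<subseteq> Poly_Mapping.keys \<alpha>" by blast
    then show "strand Q \<alpha> S \<subseteq> {0 :: 'a}" by (auto simp: strand_def)
  qed (simp add: strand_def)
next
  case False
  then obtain x where x: "x \<in> T" "x \<in> Poly_Mapping.keys \<alpha>" by auto
  have "acyclic_at (\<lambda>_. 1) (insert x (T - {x})) p (strand Q \<alpha> :: _ \<Rightarrow> 'a set)"
  proof (rule acyclic_cone[OF strand_stable[OF Q]])
    fix S assume "S \<subseteq> T - {x}"
    then show "strand Q \<alpha> S \<subseteq> (strand Q \<alpha> (insert x S) :: 'a set)"
      using full[of "insert x S"] x by (auto simp: strand_def)
  qed simp
  with x show ?thesis by (simp add: insert_absorb)
qed

abbreviation ideal_strand ::
    "('n::finite \<Rightarrow>\<^sub>0 nat) set \<Rightarrow> ('n \<Rightarrow>\<^sub>0 nat) \<Rightarrow> 'n set \<Rightarrow> 'a::zero set" where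
  "ideal_strand J \<equiv> strand (\<lambda>m S. m \<in> J)"

text \<open>
  Adding \<open>x\<close> to \<open>S\<close> has the same effect on \<open>x\<^sup>\<alpha> / x\<^sup>S\<close> as dividing \<open>x\<^sup>\<alpha>\<close> by \<open>x\<close>, so links are
  strands of smaller multidegree.
\<close>

lemma ideal_strand_link:
  assumes "x \<notin> S"
  shows "ideal_strand J \<alpha> (insert x S) =
    (if x \<in> Poly_Mapping.keys \<alpha> then ideal_strand J (\<alpha> - Poly_Mapping.single x 1) S else {0})"
proof -
  have "\<alpha> - ind (insert x S) = \<alpha> - Poly_Mapping.single x 1 - ind S"
    using assms by (simp add: ind_insert diff_diff_add)
  moreover have "S \<subseteq> Poly_Mapping.keys (\<alpha> - Poly_Mapping.single x 1) \<longleftrightarrow> S \<subseteq> Poly_Mapping.keys \<alpha>"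
  proof -
    have "y \<in> Poly_Mapping.keys (\<alpha> - Poly_Mapping.single x 1) \<longleftrightarrow> y \<in> Poly_Mapping.keys \<alpha>" if "y \<in> S" for y
      using that assms by (auto simp: in_keys_iff lookup_minus lookup_single when_def)
    then show ?thesis by auto
  qed
  ultimately show ?thesis by (auto simp: strand_def)
qed

lemma ideal_strand_link_acyclic:
  assumes x: "x \<notin> T"
    and "x \<in> Poly_Mapping.keys \<alpha> \<Longrightarrow>
      acyclic_at X T p (ideal_strand J (\<alpha> - Poly_Mapping.single x 1) :: _ \<Rightarrow> 'a::comm_ring_1 set)"
  shows "acyclic_at X T p (\<lambda>S. ideal_strand J \<alpha> (insert x S) :: 'a set)"
proof (cases "x \<in> Poly_Mapping.keys \<alpha>")
  case True
  have "acyclic_at X T p (\<lambda>S. ideal_strand J \<alpha> (insert x S) :: 'a set)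
      = acyclic_at X T p (ideal_strand J (\<alpha> - Poly_Mapping.single x 1))"
    by (rule acyclic_at_cong, subst ideal_strand_link) (use x True in auto)
  with assms(2)[OF True] show ?thesis by simp
next
  case False
  show ?thesis
  proof (rule acyclic_at_trivial)
    fix S assume "S \<subseteq> T"
    then have "x \<notin> S" using x by auto
    then show "ideal_strand J \<alpha> (insert x S) \<subseteq> {0 :: 'a}"
      using False by (simp add: ideal_strand_link)
  qed (simp add: strand_def)
qed

text \<open>
  Induction on the exponent of \<open>x\<close> in \<open>\<alpha>\<close>, using that the link of \<open>x\<close> belongs to the
  multidegree where this exponent is one less. If the exponent is 0, the link is zero.
\<close>

lemma ideal_strand_delete:
  assumes J: "shift_closed (\<lambda>m S. m \<in> J)" and x: "x \<notin> T"
    and "\<And>r. r \<le> Poly_Mapping.lookup \<alpha> x \<Longrightarrow>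
      acyclic_at (\<lambda>_. 1) (insert x T) p
        (ideal_strand J (\<alpha> - Poly_Mapping.single x r) :: _ \<Rightarrow> 'a::comm_ring_1 set)"
  shows "acyclic_at (\<lambda>_. 1) T p (ideal_strand J \<alpha> :: _ \<Rightarrow> 'a set)"
  using assms(3)
proof (induction "Poly_Mapping.lookup \<alpha> x" arbitrary: \<alpha>)
  case (0 \<alpha>)
  have "acyclic_at (\<lambda>_. 1) T p (\<lambda>S. ideal_strand J \<alpha> (insert x S) :: 'a set)"
    by (rule ideal_strand_link_acyclic[OF x]) (use 0 in \<open>simp add: in_keys_iff\<close>)
  with 0(2)[of 0] show ?case
    by (intro acyclic_delete[OF strand_stable[OF J] x]) auto
next
  case (Suc n \<alpha>)
  have "acyclic_at (\<lambda>_. 1) T p (\<lambda>S. ideal_strand J \<alpha> (insert x S) :: 'a set)"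
  proof (rule ideal_strand_link_acyclic[OF x], rule Suc(1))
    show "n = Poly_Mapping.lookup (\<alpha> - Poly_Mapping.single x 1) x"
      using Suc(2) by (simp add: lookup_minus)
  next
    fix r assume "r \<le> Poly_Mapping.lookup (\<alpha> - Poly_Mapping.single x 1) x"
    then have "Suc r \<le> Poly_Mapping.lookup \<alpha> x"
      using Suc(2) by (simp add: lookup_minus)
    moreover have "\<alpha> - Poly_Mapping.single x 1 - Poly_Mapping.single x r = \<alpha> - Poly_Mapping.single x (Suc r)"
      by (simp add: diff_diff_add flip: single_add)
    ultimately show "acyclic_at (\<lambda>_. 1) (insert x T) p
        (ideal_strand J (\<alpha> - Poly_Mapping.single x 1 - Poly_Mapping.single x r) :: _ \<Rightarrow> 'a set)"
      using Suc(3)[of "Suc r"] by simp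
  qed
  with Suc(3)[of 0] show ?case
    by (intro acyclic_delete[OF strand_stable[OF J] x]) auto
qed

lemma ideal_strand_insert:
  assumes "shift_closed (\<lambda>m S. m \<in> J)" "x \<notin> T"
    and "acyclic_at (\<lambda>_. 1) T (Suc p) (ideal_strand J \<alpha> :: _ \<Rightarrow> 'a::comm_ring_1 set)"
    and "acyclic_at (\<lambda>_. 1) T p (ideal_strand J (\<alpha> - Poly_Mapping.single x 1) :: _ \<Rightarrow> 'a::comm_ring_1 set)"
  shows "acyclic_at (\<lambda>_. 1) (insert x T) (Suc p) (ideal_strand J \<alpha> :: _ \<Rightarrow> 'a set)"
  using assms by (intro acyclic_insert strand_stable ideal_strand_link_acyclic) auto

section \<open>Ideals generated by quadratic monomials\<close>

definition up_set :: "('n \<Rightarrow>\<^sub>0 nat) set \<Rightarrow> ('n \<Rightarrow>\<^sub>0 nat) set" where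
  "up_set G = {g + m |g m. g \<in> G}"

lemma up_set_add: "m \<in> up_set G \<Longrightarrow> m + n \<in> up_set G"
  unfolding up_set_def using add.assoc by blast

lemma shift_closed_up_set: "shift_closed (\<lambda>m S. m \<in> up_set G)"
  by (simp add: shift_closed_def up_set_add)

lemma up_setI:
  assumes "g \<in> G" "\<And>x. Poly_Mapping.lookup g x \<le> Poly_Mapping.lookup m x"
  shows "m \<in> up_set G"
proof -
  have "m = g + (m - g)" using exponent_minus_plus[OF assms(2)] by (simp add: add.commute)
  with assms(1) show ?thesis unfolding up_set_def by blast
qed

lemma lookup_le_monomial_degree: "Poly_Mapping.lookup g x \<le> monomial_degree g"
  by (simp add: monomial_degree_def member_le_sum)

lemma monomial_degree_pos_obtain:
  assumes "0 < monomial_degree g"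
  obtains x where "0 < Poly_Mapping.lookup g x"
  using assms unfolding monomial_degree_def by (metis gr0I less_irrefl sum.neutral)

text \<open>
  If no generator divides \<open>x\<^sup>\<alpha>\<close>, the strand is zero, and if some variable has a larger exponent in
  \<open>\<alpha>\<close> than in all generators, it is a cone. Otherwise all exponents in \<open>\<alpha>\<close> are at most 2, and
  \<open>x\<^sup>\<alpha>\<close> is divisible either by a generator \<open>x\<^sup>2\<close> with \<open>\<alpha>\<^sub>x = 2\<close>, or by a generator \<open>x y\<close> with
  \<open>\<alpha>\<^sub>x = \<alpha>\<^sub>y = 1\<close>. Without the variables of this generator in \<open>S\<close>, the monomial \<open>x\<^sup>\<alpha> / x\<^sup>S\<close> remains
  in the ideal, so that the strand over the other variables is a full simplex and hence acyclic.
  Inserting the deleted variables one after the other only involves links, that is, strands at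
  multidegrees dividing \<open>\<alpha>\<close> by a divisor of the generator; these lose at most two degrees and
  are covered by the hypothesis.
\<close>

theorem quadratic_strand_acyclic:
  assumes G: "\<And>g. g \<in> G \<Longrightarrow> monomial_degree g = 2"
    and hyp: "\<And>\<beta>. monomial_degree \<alpha> \<le> monomial_degree \<beta> + 2 \<Longrightarrow>
      acyclic_at (\<lambda>_. 1) UNIV p (ideal_strand (up_set G) \<beta> :: _ \<Rightarrow> 'a::comm_ring_1 set)"
  shows "acyclic_at (\<lambda>_. 1) UNIV (Suc p) (ideal_strand (up_set G) \<alpha> :: _ \<Rightarrow> 'a set)"
proof -
  let ?J = "up_set G"
  note J = shift_closed_up_set[of G]
  let ?A = "\<lambda>T q \<beta>. acyclic_at (\<lambda>_. 1) T q (ideal_strand ?J \<beta> :: _ \<Rightarrow> 'a set)"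
  consider (out) "\<alpha> \<notin> ?J"
    | (cone) x where "x \<in> Poly_Mapping.keys \<alpha>"
        "\<And>g. g \<in> G \<Longrightarrow> Poly_Mapping.lookup g x < Poly_Mapping.lookup \<alpha> x"
    | (tight) "\<alpha> \<in> ?J" "\<And>x. x \<in> Poly_Mapping.keys \<alpha> \<Longrightarrow>
        \<exists>g\<in>G. Poly_Mapping.lookup \<alpha> x \<le> Poly_Mapping.lookup g x"
    by (meson not_less)
  then show ?thesis
  proof cases
    case out
    show ?thesis
    proof (rule acyclic_at_trivial)
      fix S
      have "\<not> (S \<subseteq> Poly_Mapping.keys \<alpha> \<and> \<alpha> - ind S \<in> ?J)"
        using out minus_ind_plus_ind up_set_add by metis
      then show "ideal_strand ?J \<alpha> S \<subseteq> {0 :: 'a}" by (auto simp: strand_def)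
    qed (simp add: strand_def)
  next
    case cone
    have "?A (insert x (UNIV - {x})) (Suc p) \<alpha>"
    proof (rule acyclic_cone[OF strand_stable[OF J]])
      fix S assume S: "S \<subseteq> UNIV - {x}"
      have "\<alpha> - ind (insert x S) \<in> ?J" if mem: "\<alpha> - ind S \<in> ?J"
      proof -
        obtain g m where g: "g \<in> G" "\<alpha> - ind S = g + m"
          using mem unfolding up_set_def by blast
        show ?thesis
        proof (rule up_setI[OF g(1)])
          fix y
          have "Poly_Mapping.lookup \<alpha> y - Poly_Mapping.lookup (ind S) y
              = Poly_Mapping.lookup g y + Poly_Mapping.lookup m y"
            using arg_cong[OF g(2), of "\<lambda>m. Poly_Mapping.lookup m y"]
            by (simp add: lookup_minus lookup_add)
          then show "Poly_Mapping.lookup g y \<le> Poly_Mapping.lookup (\<alpha> - ind (insert x S)) y"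
            using cone(2)[OF g(1)] S
            by (cases "y = x") (auto simp: lookup_minus lookup_ind split: if_splits)
        qed
      qed
      then show "ideal_strand ?J \<alpha> S \<subseteq> (ideal_strand ?J \<alpha> (insert x S) :: 'a set)"
        using cone(1) by (auto simp: strand_def)
    qed simp
    then show ?thesis by (simp add: insert_absorb)
  next
    case tight
    show ?thesis
    proof (cases "\<exists>x. 2 \<le> Poly_Mapping.lookup \<alpha> x")
      case True
      then obtain x where x: "2 \<le> Poly_Mapping.lookup \<alpha> x" by blast
      then have "x \<in> Poly_Mapping.keys \<alpha>" by (simp add: in_keys_iff)
      with tight(2) obtain g where g: "g \<in> G" "Poly_Mapping.lookup \<alpha> x \<le> Poly_Mapping.lookup g x"
        by blast
      have gx: "Poly_Mapping.lookup g x = 2" and ax: "Poly_Mapping.lookup \<alpha> x = 2"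
        using x g(2) lookup_le_monomial_degree[of g x] G[OF g(1)] by auto
      \<comment> \<open>The generator is the square of \<open>x\<close>, as its degree is used up by this variable.\<close>
      have g0: "Poly_Mapping.lookup g y = 0" if "y \<noteq> x" for y
      proof -
        have "monomial_degree (g - Poly_Mapping.single x 2) = 0"
          using monomial_degree_minus_single[of 2 g x] gx G[OF g(1)] by simp
        then have "Poly_Mapping.lookup (g - Poly_Mapping.single x 2) y = 0"
          by (metis le_0_eq lookup_le_monomial_degree)
        with that show ?thesis by (simp add: lookup_minus lookup_single when_def)
      qed
      let ?T = "UNIV - {x}"
      have "?A ?T (Suc p) \<alpha>"
      proof (rule strand_full_acyclic[OF J])
        fix S assume "S \<subseteq> ?T"
        then show "\<alpha> - ind S \<in> ?J"
          by (intro up_setI[OF g(1)]) (metis Diff_iff ax bot_nat_0.extremum diff_zero g0 gx insertI1 lookup_ind lookup_minus order_refl subset_iff)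
      qed simp
      moreover have "?A ?T p (\<alpha> - Poly_Mapping.single x 1)"
      proof (rule ideal_strand_delete[OF J, of x])
        fix r assume "r \<le> Poly_Mapping.lookup (\<alpha> - Poly_Mapping.single x 1) x"
        then have r: "Suc r \<le> Poly_Mapping.lookup \<alpha> x" "r \<le> 1" using ax by (auto simp: lookup_minus)
        have *: "\<alpha> - Poly_Mapping.single x 1 - Poly_Mapping.single x r = \<alpha> - Poly_Mapping.single x (Suc r)"
          by (simp add: diff_diff_add flip: single_add)
        show "?A (insert x ?T) p (\<alpha> - Poly_Mapping.single x 1 - Poly_Mapping.single x r)"
          unfolding * insert_Diff_single insert_UNIV
          by (rule hyp) (use monomial_degree_minus_single[OF r(1)] r(2) in simp)
      qed simp
      ultimately have "?A (insert x ?T) (Suc p) \<alpha>"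
        by (intro ideal_strand_insert[OF J]) auto
      then show ?thesis by (simp add: insert_absorb)
    next
      case False
      then have le1: "Poly_Mapping.lookup \<alpha> y \<le> 1" for y
        by (metis less_2_cases_iff linorder_not_less nle_le One_nat_def zero_le)
      obtain g m where g: "g \<in> G" "\<alpha> = g + m" using tight(1) unfolding up_set_def by blast
      have g_le: "Poly_Mapping.lookup g y \<le> Poly_Mapping.lookup \<alpha> y" for y
        by (simp add: g(2) lookup_add)
      have g2: "monomial_degree g = 2" using G g(1) .
      then obtain x where x: "0 < Poly_Mapping.lookup g x"
        using monomial_degree_pos_obtain by (metis zero_less_numeral)
      have gx: "Poly_Mapping.lookup g x = 1" using x g_le[of x] le1[of x] by simp
      have d1: "monomial_degree (g - Poly_Mapping.single x 1) = 1"
        using monomial_degree_minus_single[of 1 g x] gx g2 by simp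
      then obtain y where y: "0 < Poly_Mapping.lookup (g - Poly_Mapping.single x 1) y"
        using monomial_degree_pos_obtain by (metis zero_less_one)
      have yx: "y \<noteq> x" using y gx by (auto simp: lookup_minus)
      have gy: "Poly_Mapping.lookup g y = 1"
        using y yx g_le[of y] le1[of y] by (simp add: lookup_minus lookup_single when_def)
      have g0: "Poly_Mapping.lookup g z = 0" if "z \<noteq> x" "z \<noteq> y" for z
      proof -
        have "monomial_degree (g - Poly_Mapping.single x 1 - Poly_Mapping.single y 1) = 0"
          using monomial_degree_minus_single[of 1 "g - Poly_Mapping.single x 1" y] d1 y by simp
        then have "Poly_Mapping.lookup (g - Poly_Mapping.single x 1 - Poly_Mapping.single y 1) z = 0"
          by (metis le_0_eq lookup_le_monomial_degree)
        with that show ?thesis by (simp add: lookup_minus lookup_single when_def)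
      qed
      have ax: "Poly_Mapping.lookup \<alpha> x = 1" and ay: "Poly_Mapping.lookup \<alpha> y = 1"
        using g_le[of x] g_le[of y] le1[of x] le1[of y] gx gy by auto
      let ?T = "UNIV - {x, y}" and ?U = "UNIV - {x}"
      have U: "insert y ?T = ?U" using yx by auto
      have V: "insert x ?U = UNIV" by auto
      \<comment> \<open>Deleting \<open>x\<close> in multidegree \<open>\<beta>\<close> costs up to \<open>\<beta>\<^sub>x\<close> of the two available degrees.\<close>
      have dx: "?A ?U p \<beta>" if "monomial_degree \<alpha> \<le> monomial_degree \<beta> + 2 - Poly_Mapping.lookup \<beta> x" for \<beta>
      proof (rule ideal_strand_delete[OF J, of x])
        fix r assume r: "r \<le> Poly_Mapping.lookup \<beta> x"
        show "?A (insert x ?U) p (\<beta> - Poly_Mapping.single x r)"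
          unfolding V by (rule hyp) (use monomial_degree_minus_single[OF r] that r in linarith)
      qed simp
      have deg_x: "monomial_degree (\<alpha> - Poly_Mapping.single x 1) + 1 = monomial_degree \<alpha>"
        and deg_y: "monomial_degree (\<alpha> - Poly_Mapping.single y 1) + 1 = monomial_degree \<alpha>"
        by (rule monomial_degree_minus_single; simp add: ax ay)+
      have 1: "?A ?T (Suc p) \<alpha>"
      proof (rule strand_full_acyclic[OF J])
        fix S assume S: "S \<subseteq> ?T"
        show "\<alpha> - ind S \<in> ?J"
        proof (rule up_setI[OF g(1)])
          fix z
          show "Poly_Mapping.lookup g z \<le> Poly_Mapping.lookup (\<alpha> - ind S) z"
            using S g_le[of z] g0[of z]
            by (cases "z = x \<or> z = y") (auto simp: lookup_minus lookup_ind)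
        qed
      qed simp
      have 2: "?A ?U p (\<alpha> - Poly_Mapping.single y 1)"
        by (rule dx) (use deg_y yx in \<open>simp add: lookup_minus lookup_single when_def ax\<close>)
      have 3: "?A ?T p (\<alpha> - Poly_Mapping.single y 1)"
      proof (rule ideal_strand_delete[OF J, of y])
        fix r assume "r \<le> Poly_Mapping.lookup (\<alpha> - Poly_Mapping.single y 1) y"
        then have "r = 0" by (simp add: lookup_minus ay)
        with 2 show "?A (insert y ?T) p (\<alpha> - Poly_Mapping.single y 1 - Poly_Mapping.single y r)"
          by (simp add: U)
      qed simp
      have 4: "?A ?U (Suc p) \<alpha>"
        using ideal_strand_insert[OF J _ 1 3] unfolding U by simp
      have 5: "?A ?U p (\<alpha> - Poly_Mapping.single x 1)"
        by (rule dx) (use deg_x in \<open>simp add: lookup_minus ax\<close>)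
      show ?thesis using ideal_strand_insert[OF J _ 4 5] unfolding V by simp
    qed
  qed
qed

section \<open>Dimension shifting\<close>

text \<open>
  The long exact sequence of \<open>0 \<rightarrow> C \<rightarrow> E \<rightarrow> B \<rightarrow> 0\<close> with acyclic middle term gives
  \<open>H\<^sub>p\<^sub>+\<^sub>1(B) = H\<^sub>p(C)\<close>. The sequence has to be exact on the right at nonempty sets,
  where the chains in positions \<open>p + 1\<close> and \<open>p + 2\<close> are supported. This lets \<open>E\<close> be the chains of
  a free module cut down to the maximal ideal at the empty set, which is what makes them
  acyclic also in position 0.
\<close>

lemma acyclic_at_dimension_shift:
  fixes X :: "'n::finite \<Rightarrow> 'a::comm_ring_1"
  assumes add: "\<And>u v. f (u + v) = f u + (f v :: 'a)"
    and act: "\<And>j v. f (X j * v) = X j * f v"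
    and E: "koszul_stable X E"
    and ker: "\<And>S. C S = {v \<in> E S. f v = 0}"
    and onto: "\<And>S. S \<noteq> {} \<Longrightarrow> B S = f ` E S"
    and Ep: "acyclic_at X T p E" and Ep': "acyclic_at X T (Suc p) E"
  shows "acyclic_at X T p C \<longleftrightarrow> acyclic_at X T (Suc p) B"
proof -
  have f0: "f 0 = 0" using add[of 0 0] by simp
  have fm: "f (- v) = - f v" for v using add[of v "- v"] f0 by (simp add: eq_neg_iff_add_eq_0 add.commute)
  have fd: "f (u - v) = f u - f v" for u v using add[of u "- v"] fm by simp
  have fs: "f (sum g A) = (\<Sum>a\<in>A. f (g a))" for g :: "'n \<Rightarrow> 'a" and A
    by (induction A rule: infinite_finite_induct) (auto simp: f0 add)
  have fsign: "f (ksign j S * v) = ksign j S * f v" for j :: 'n and S v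
    using ksign_cases[of j S] by (metis fm mult_1 mult_minus1)
  have nat: "koszul X T (\<lambda>S. f (c S)) S = f (koszul X T c S)" for c S
    by (simp add: koszul_def fs mult.assoc fsign act)
  have lift: "\<exists>e\<in>chains T (Suc q) E. \<forall>S. f (e S) = c S" if c: "c \<in> chains T (Suc q) B" for c q
  proof -
    have "\<exists>v. (if S \<subseteq> T \<and> card S = Suc q then v \<in> E S else v = 0) \<and> f v = c S" for S
    proof (cases "S \<subseteq> T \<and> card S = Suc q")
      case True
      then have "S \<noteq> {}" by auto
      with True chains_mem[OF c, of S] onto show ?thesis by auto
    next
      case False
      then show ?thesis using chains_zero[OF c, of S] f0 by auto
    qed
    then have "\<forall>S. \<exists>v. (if S \<subseteq> T \<and> card S = Suc q then v \<in> E S else v = 0) \<and> f v = c S" by blast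
    from choice[OF this] obtain e where
      e: "\<forall>S. (if S \<subseteq> T \<and> card S = Suc q then e S \<in> E S else e S = 0) \<and> f (e S) = c S"
      by blast
    have "e \<in> chains T (Suc q) E" using e by (simp add: chains_def)
    with e show ?thesis by blast
  qed
  have push: "(\<lambda>S. f (e S)) \<in> chains T (Suc q) B" if e: "e \<in> chains T (Suc q) E" for e q
  proof (rule chainsI)
    fix S assume S: "S \<subseteq> T" "card S = Suc q"
    then have "S \<noteq> {}" by auto
    with S show "f (e S) \<in> B S" using onto chains_mem[OF e] by auto
  next
    fix S assume "\<not> (S \<subseteq> T \<and> card S = Suc q)"
    then show "f (e S) = 0" using chains_zero[OF e] f0 by simp
  qed
  have in_E: "e \<in> chains T q E" if "e \<in> chains T q C" for e q
    using that ker by (auto simp: chains_def split: if_splits)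
  have in_C: "e \<in> chains T q C" if "e \<in> chains T q E" "\<And>S. f (e S) = 0" for e q
    using that ker by (auto simp: chains_def)
  have diff: "(\<lambda>S. a S - b S) \<in> chains T q E" if a: "a \<in> chains T q E" and b: "b \<in> chains T q E" for a b q
  proof (rule chainsI)
    fix S assume "S \<subseteq> T" "card S = q"
    then show "a S - b S \<in> E S"
      using koszul_stable_add[OF E chains_mem[OF a] koszul_stable_minus[OF E chains_mem[OF b]]] by simp
  next
    fix S assume "\<not> (S \<subseteq> T \<and> card S = q)"
    then show "a S - b S = 0" using chains_zero[OF a] chains_zero[OF b] by simp
  qed
  show ?thesis
  proof
    assume C: "acyclic_at X T p C"
    show "acyclic_at X T (Suc p) B"
      unfolding acyclic_at_def
    proof (intro ballI impI)
      fix c assume c: "c \<in> chains T (Suc p) B" and cyc: "\<forall>S. koszul X T c S = 0"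
      obtain e where e: "e \<in> chains T (Suc p) E" and ec: "\<And>S. f (e S) = c S"
        using lift[OF c] by blast
      have "f (koszul X T e S) = 0" for S
        using nat[of e S] cyc by (simp add: ec)
      then have "koszul X T e \<in> chains T p C"
        by (intro in_C koszul_in_chains[OF E e])
      then obtain e' where e': "e' \<in> chains T (Suc p) C" and ee': "\<And>S. koszul X T e' S = koszul X T e S"
        by (rule acyclic_atD[OF C _ koszul_koszul]) blast
      have "koszul X T (\<lambda>S. e S - e' S) S = 0" for S
        by (simp add: koszul_diff ee')
      then obtain g where g: "g \<in> chains T (Suc (Suc p)) E" and ge: "\<And>S. koszul X T g S = e S - e' S"
        by (rule acyclic_atD[OF Ep' diff[OF e in_E[OF e']]]) blast
      have "f (e' S) = 0" for S
        using chains_mem[OF e', of S] chains_zero[OF e', of S] ker f0 by (cases "S \<subseteq> T \<and> card S = Suc p") auto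
      then have "koszul X T (\<lambda>S. f (g S)) S = c S" for S
        by (simp add: nat ge fd ec)
      with push[OF g] show "\<exists>b\<in>chains T (Suc (Suc p)) B. \<forall>S. koszul X T b S = c S" by blast
    qed
  next
    assume B: "acyclic_at X T (Suc p) B"
    show "acyclic_at X T p C"
      unfolding acyclic_at_def
    proof (intro ballI impI)
      fix z assume z: "z \<in> chains T p C" and cyc: "\<forall>S. koszul X T z S = 0"
      obtain e where e: "e \<in> chains T (Suc p) E" and ez: "\<And>S. koszul X T e S = z S"
        using acyclic_atD[OF Ep in_E[OF z]] cyc by blast
      have "f (z S) = 0" for S
        using chains_mem[OF z, of S] chains_zero[OF z, of S] ker f0 by (cases "S \<subseteq> T \<and> card S = p") auto
      then have "koszul X T (\<lambda>S. f (e S)) S = 0" for S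
        by (simp add: nat ez)
      then obtain b where b: "b \<in> chains T (Suc (Suc p)) B" and be: "\<And>S. koszul X T b S = f (e S)"
        by (rule acyclic_atD[OF B push[OF e]]) blast
      obtain g where g: "g \<in> chains T (Suc (Suc p)) E" and gb: "\<And>S. f (g S) = b S"
        using lift[OF b] by blast
      let ?h = "\<lambda>S. e S - koszul X T g S"
      have "?h \<in> chains T (Suc p) C"
      proof (rule in_C[OF diff[OF e koszul_in_chains[OF E g]]])
        fix S
        have "f (koszul X T g S) = f (e S)" using nat[of g S] by (simp add: gb be)
        then show "f (?h S) = 0" by (simp add: fd)
      qed
      moreover have "koszul X T ?h S = z S" for S
        by (simp add: koszul_diff koszul_koszul ez)
      ultimately show "\<exists>b\<in>chains T (Suc p) C. \<forall>S. koszul X T b S = z S" by blast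
    qed
  qed
qed

section \<open>Multigraded decomposition of Koszul complexes\<close>

lemma lookup_single_mult_add:
  fixes p :: "('n \<Rightarrow>\<^sub>0 nat) \<Rightarrow>\<^sub>0 'k::comm_ring_1"
  shows "Poly_Mapping.lookup (Poly_Mapping.single e c * p) (m + e) = c * Poly_Mapping.lookup p m"
proof -
  have *: "m + e = e + q \<longleftrightarrow> q = m" for q
    by (metis add.commute add_left_cancel)
  show ?thesis by (simp add: lookup_mult lookup_single when_mult * )
qed

lemma lookup_single_mult_nondivisor:
  fixes p :: "('n \<Rightarrow>\<^sub>0 nat) \<Rightarrow>\<^sub>0 'k::comm_ring_1"
  assumes "Poly_Mapping.lookup m j < Poly_Mapping.lookup e j"
  shows "Poly_Mapping.lookup (Poly_Mapping.single e c * p) m = 0"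
proof -
  have *: "m \<noteq> e + q" for q
    using assms by (auto simp: lookup_add)
  show ?thesis by (simp add: lookup_mult lookup_single when_mult * )
qed

abbreviation coeff :: "(nat \<Rightarrow>\<^sub>0 ('n, 'k::zero) mpoly) \<Rightarrow> nat \<Rightarrow> ('n \<Rightarrow>\<^sub>0 nat) \<Rightarrow> 'k" where
  "coeff v k m \<equiv> Poly_Mapping.lookup (Poly_Mapping.lookup v k) m"

text \<open>
  The finitely supported functions from \<^typ>\<open>nat\<close> form a ring under convolution, in which
  multiplication by an element supported at 0 is scalar multiplication. So the variables
  act on vectors by ring multiplication.
\<close>

definition var :: "'n \<Rightarrow> (nat \<Rightarrow>\<^sub>0 ('n, 'k::comm_ring_1) mpoly)" where
  "var j = Poly_Mapping.single 0 (monomial (Poly_Mapping.single j 1))"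

lemma vscale_conv_mult: "vscale r v = Poly_Mapping.single 0 r * v"
  by (simp add: vscale_def mult_map_scale_conv_mult)

lemma var_mult: "var j * v = vscale (monomial (Poly_Mapping.single j 1)) v"
  by (simp add: var_def vscale_conv_mult)

lemma coeff_var_mult: "coeff (var j * v) k (m + Poly_Mapping.single j 1) = coeff v k m"
  by (simp add: var_mult lookup_vscale monomial_def lookup_single_mult_add)

lemma coeff_var_mult_0: "Poly_Mapping.lookup m j = 0 \<Longrightarrow> coeff (var j * v) k m = 0"
  unfolding var_mult lookup_vscale monomial_def
  by (rule lookup_single_mult_nondivisor[where j=j]) simp

lemma coeff_ksign: "coeff (ksign j S * v) k m = ksign j S * coeff v k m"
  by (simp add: ksign_def minus_one_power_iff)

lemma coeff_eqI: "(\<And>k m. coeff v k m = coeff w k m) \<Longrightarrow> v = w"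
  by (intro poly_mapping_eqI)

lemma coeff_sum: "coeff (sum f A) k m = (\<Sum>a\<in>A. coeff (f a) k m)"
  by (simp add: lookup_sum)

text \<open>
  Coefficient sets that are spanned by monomials, \<open>Q k m S\<close> telling whether the monomial \<open>m\<close> times
  the \<open>k\<close>-th basis vector is admitted at \<open>S\<close>. Both free modules and monomial ideals are of this
  kind.
\<close>

definition monomial_family ::
    "(nat \<Rightarrow> ('n::finite \<Rightarrow>\<^sub>0 nat) \<Rightarrow> 'n set \<Rightarrow> bool) \<Rightarrow> 'n set \<Rightarrow> (nat \<Rightarrow>\<^sub>0 ('n, 'k::comm_ring_1) mpoly) set"
  where "monomial_family Q S = {v. \<forall>k m. coeff v k m \<noteq> 0 \<longrightarrow> Q k m S}"

lemma var_mult_coeff_cases: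
  assumes "coeff (var j * v) k m \<noteq> 0"
  obtains m' where "m = m' + Poly_Mapping.single j 1" "coeff v k m' \<noteq> 0"
proof -
  have "Poly_Mapping.lookup m j \<noteq> 0" using assms coeff_var_mult_0[of m j v k] by auto
  then have "m - Poly_Mapping.single j 1 + Poly_Mapping.single j 1 = m"
    by (intro exponent_minus_plus) (auto simp: lookup_single when_def)
  with assms show ?thesis using that coeff_var_mult by metis
qed

lemma monomial_family_stable:
  assumes "\<And>k. shift_closed (Q k)"
  shows "koszul_stable var (monomial_family Q :: _ \<Rightarrow> (nat \<Rightarrow>\<^sub>0 ('n::finite, 'k::comm_ring_1) mpoly) set)"
proof (rule koszul_stableI)
  fix S j and v :: "nat \<Rightarrow>\<^sub>0 ('n, 'k) mpoly"
  assume "j \<notin> S" and v: "v \<in> monomial_family Q (insert j S)"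
  with assms show "var j * v \<in> monomial_family Q S"
    unfolding monomial_family_def shift_closed_def
    by (auto elim!: var_mult_coeff_cases)
next
  fix S and u v :: "nat \<Rightarrow>\<^sub>0 ('n, 'k) mpoly"
  assume "u \<in> monomial_family Q S" "v \<in> monomial_family Q S"
  then show "u + v \<in> monomial_family Q S"
    unfolding monomial_family_def mem_Collect_eq lookup_add by (metis add_0)
qed (auto simp: monomial_family_def)

text \<open>
  Passing between chains of vectors of polynomials and their multihomogeneous components in one
  coordinate \<open>k\<close>, which are chains of scalars.
\<close>

definition strand_coeff ::
    "nat \<Rightarrow> ('n::finite \<Rightarrow>\<^sub>0 nat) \<Rightarrow> ('n set \<Rightarrow> (nat \<Rightarrow>\<^sub>0 ('n, 'k::comm_ring_1) mpoly)) \<Rightarrow> 'n set \<Rightarrow> 'k" where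
  "strand_coeff k \<alpha> c S = (if S \<subseteq> Poly_Mapping.keys \<alpha> then coeff (c S) k (\<alpha> - ind S) else 0)"

definition strand_embed ::
    "nat \<Rightarrow> ('n::finite \<Rightarrow>\<^sub>0 nat) \<Rightarrow> ('n set \<Rightarrow> 'k::comm_ring_1) \<Rightarrow> 'n set \<Rightarrow> (nat \<Rightarrow>\<^sub>0 ('n, 'k) mpoly)" where
  "strand_embed k \<alpha> f S =
    (if S \<subseteq> Poly_Mapping.keys \<alpha> then Poly_Mapping.single k (Poly_Mapping.single (\<alpha> - ind S) (f S)) else 0)"

lemma coeff_as_strand_coeff: "coeff (c S) k m = strand_coeff k (m + ind S) c S"
proof -
  have "S \<subseteq> Poly_Mapping.keys (m + ind S)"
    by (auto simp: in_keys_iff lookup_add lookup_ind)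
  then show ?thesis by (simp add: strand_coeff_def)
qed

lemma strand_coeff_eqI: "(\<And>k \<alpha>. strand_coeff k \<alpha> c S = strand_coeff k \<alpha> d S) \<Longrightarrow> c S = d S"
  by (rule coeff_eqI) (simp add: coeff_as_strand_coeff)

lemma koszul_strand_coeff:
  "koszul (\<lambda>_. 1) T (strand_coeff k \<alpha> c) S = strand_coeff k \<alpha> (koszul var T c) S"
proof (cases "S \<subseteq> Poly_Mapping.keys \<alpha>")
  case True
  have "coeff (var j * c (insert j S)) k (\<alpha> - ind S) = strand_coeff k \<alpha> c (insert j S)" if "j \<in> T - S" for j
  proof (cases "j \<in> Poly_Mapping.keys \<alpha>")
    case j: True
    have "coeff (var j * c (insert j S)) k (\<alpha> - ind (insert j S) + Poly_Mapping.single j 1)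
        = coeff (c (insert j S)) k (\<alpha> - ind (insert j S))" by (rule coeff_var_mult)
    then show ?thesis using True that j minus_ind_insert[of j S \<alpha>] by (simp add: strand_coeff_def)
  next
    case False
    then have "Poly_Mapping.lookup (\<alpha> - ind S) j = 0"
      by (simp add: lookup_minus in_keys_iff)
    then show ?thesis using False by (simp add: strand_coeff_def coeff_var_mult_0)
  qed
  then show ?thesis
    using True unfolding koszul_def
    by (simp add: strand_coeff_def[of k \<alpha> _ S] coeff_sum mult.assoc coeff_ksign)
next
  case False
  then show ?thesis by (simp add: koszul_def strand_coeff_def)
qed

lemma strand_coeff_embed:
  assumes "f \<in> chains T p (strand Q \<alpha>)"
  shows "strand_coeff k' \<alpha>' (strand_embed k \<alpha> f) S = (if k = k' \<and> \<alpha> = \<alpha>' then f S else 0)"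
proof (cases "S \<subseteq> Poly_Mapping.keys \<alpha>")
  case True
  have "\<alpha> = \<alpha>'" if "S \<subseteq> Poly_Mapping.keys \<alpha>'" "\<alpha> - ind S = \<alpha>' - ind S"
    using minus_ind_plus_ind True that by metis
  with True show ?thesis
    by (auto simp: strand_coeff_def strand_embed_def lookup_single when_def)
next
  case False
  then have "f S = 0"
    using chains_mem[OF assms, of S] chains_zero[OF assms, of S] by (auto simp: strand_def)
  with False show ?thesis by (simp add: strand_coeff_def strand_embed_def)
qed

lemma strand_coeff_in_chains:
  assumes c: "c \<in> chains T p (monomial_family Q)"
  shows "strand_coeff k \<alpha> c \<in> chains T p (strand (Q k) \<alpha>)"
proof (rule chainsI)
  fix S assume "S \<subseteq> T" "card S = p"
  from chains_mem[OF c this] show "strand_coeff k \<alpha> c S \<in> strand (Q k) \<alpha> S"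
    by (auto simp: monomial_family_def strand_coeff_def strand_def)
next
  fix S assume "\<not> (S \<subseteq> T \<and> card S = p)"
  from chains_zero[OF c this] show "strand_coeff k \<alpha> c S = 0"
    by (simp add: strand_coeff_def)
qed

lemma strand_embed_in_chains:
  assumes f: "f \<in> chains T p (strand (Q k) \<alpha>)"
  shows "strand_embed k \<alpha> f \<in> chains T p (monomial_family Q)"
proof (rule chainsI)
  fix S assume "S \<subseteq> T" "card S = p"
  from chains_mem[OF f this] show "strand_embed k \<alpha> f S \<in> monomial_family Q S"
    by (auto simp: monomial_family_def strand_embed_def strand_def lookup_single when_def)
next
  fix S assume "\<not> (S \<subseteq> T \<and> card S = p)"
  from chains_zero[OF f this] show "strand_embed k \<alpha> f S = 0"
    by (simp add: strand_embed_def)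
qed

text \<open>
  The Koszul differential preserves multidegrees and acts on each coordinate separately. A cycle
  is therefore a finite sum of cycles in single strands, and a boundary can be found strand by
  strand.
\<close>

theorem monomial_family_acyclic_iff:
  "acyclic_at var T p (monomial_family Q :: _ \<Rightarrow> (nat \<Rightarrow>\<^sub>0 ('n::finite, 'k::comm_ring_1) mpoly) set)
    \<longleftrightarrow> (\<forall>k \<alpha>. acyclic_at (\<lambda>_. 1) T p (strand (Q k) \<alpha> :: _ \<Rightarrow> 'k set))"
proof (intro iffI allI)
  fix k \<alpha>
  assume ac: "acyclic_at var T p (monomial_family Q :: _ \<Rightarrow> (nat \<Rightarrow>\<^sub>0 ('n, 'k) mpoly) set)"
  show "acyclic_at (\<lambda>_. 1) T p (strand (Q k) \<alpha> :: _ \<Rightarrow> 'k set)"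
    unfolding acyclic_at_def
  proof (intro ballI impI)
    fix f :: "'n set \<Rightarrow> 'k"
    assume f: "f \<in> chains T p (strand (Q k) \<alpha>)" and cyc: "\<forall>S. koszul (\<lambda>_. 1) T f S = 0"
    note embed = strand_coeff_embed[OF f]
    have "koszul var T (strand_embed k \<alpha> f) S = (\<lambda>_. 0) S" for S
    proof (rule strand_coeff_eqI)
      fix k' \<alpha>'
      have "strand_coeff k' \<alpha>' (koszul var T (strand_embed k \<alpha> f)) S = 0"
      proof (cases "k = k' \<and> \<alpha> = \<alpha>'")
        case True
        have "strand_coeff k' \<alpha>' (strand_embed k \<alpha> f) = f"
          by (intro ext) (subst embed, simp add: True)
        then show ?thesis using cyc by (simp flip: koszul_strand_coeff)
      next
        case False
        then have "strand_coeff k' \<alpha>' (strand_embed k \<alpha> f) = (\<lambda>_. 0)" by (auto simp: embed)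
        then show ?thesis by (simp flip: koszul_strand_coeff)
      qed
      then show "strand_coeff k' \<alpha>' (koszul var T (strand_embed k \<alpha> f)) S = strand_coeff k' \<alpha>' (\<lambda>_. 0) S"
        by (simp add: strand_coeff_def[of _ _ "\<lambda>_. 0"])
    qed
    then obtain b where b: "b \<in> chains T (Suc p) (monomial_family Q)"
      and bf: "\<And>S. koszul var T b S = strand_embed k \<alpha> f S"
      by (rule acyclic_atD[OF ac strand_embed_in_chains[where Q=Q, OF f]]) blast
    have "koszul (\<lambda>_. 1) T (strand_coeff k \<alpha> b) S = f S" for S
    proof -
      have "koszul (\<lambda>_. 1) T (strand_coeff k \<alpha> b) S = strand_coeff k \<alpha> (strand_embed k \<alpha> f) S"
        unfolding koszul_strand_coeff by (simp add: strand_coeff_def bf)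
      then show ?thesis by (simp add: embed)
    qed
    with strand_coeff_in_chains[OF b]
    show "\<exists>b\<in>chains T (Suc p) (strand (Q k) \<alpha>). \<forall>S. koszul (\<lambda>_. 1) T b S = f S" by blast
  qed
next
  assume ac: "\<forall>k \<alpha>. acyclic_at (\<lambda>_. 1) T p (strand (Q k) \<alpha> :: _ \<Rightarrow> 'k set)"
  show "acyclic_at var T p (monomial_family Q :: _ \<Rightarrow> (nat \<Rightarrow>\<^sub>0 ('n, 'k) mpoly) set)"
    unfolding acyclic_at_def
  proof (intro ballI impI)
    fix c :: "'n set \<Rightarrow> (nat \<Rightarrow>\<^sub>0 ('n, 'k) mpoly)"
    assume c: "c \<in> chains T p (monomial_family Q)" and cyc: "\<forall>S. koszul var T c S = 0"
    have "koszul (\<lambda>_. 1) T (strand_coeff k \<alpha> c) S = 0" for k \<alpha> S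
      unfolding koszul_strand_coeff by (simp add: strand_coeff_def cyc)
    then have "\<exists>g\<in>chains T (Suc p) (strand (Q k) \<alpha>).
        \<forall>S. koszul (\<lambda>_. 1) T g S = strand_coeff k \<alpha> c S" for k \<alpha>
      using ac strand_coeff_in_chains[OF c, of k \<alpha>] unfolding acyclic_at_def by blast
    then obtain g where g: "\<And>k \<alpha>. g k \<alpha> \<in> chains T (Suc p) (strand (Q k) \<alpha>)"
      and gc: "\<And>k \<alpha> S. koszul (\<lambda>_. 1) T (g k \<alpha>) S = strand_coeff k \<alpha> c S"
      by metis
    \<comment> \<open>Only finitely many strands contribute, so that their boundaries can be added up.\<close>
    define A where "A = {(k, \<alpha>). \<exists>S. strand_coeff k \<alpha> c S \<noteq> 0}"
    have "A \<subseteq> (\<Union>S. \<Union>k\<in>Poly_Mapping.keys (c S).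
        (\<lambda>m. (k, m + ind S)) ` Poly_Mapping.keys (Poly_Mapping.lookup (c S) k))"
    proof
      fix a assume "a \<in> A"
      then obtain k \<alpha> S where a: "a = (k, \<alpha>)" "strand_coeff k \<alpha> c S \<noteq> 0"
        unfolding A_def by blast
      then have S: "S \<subseteq> Poly_Mapping.keys \<alpha>" "coeff (c S) k (\<alpha> - ind S) \<noteq> 0"
        by (auto simp: strand_coeff_def split: if_splits)
      then have "k \<in> Poly_Mapping.keys (c S)" "\<alpha> - ind S \<in> Poly_Mapping.keys (Poly_Mapping.lookup (c S) k)"
        by (auto simp: in_keys_iff)
      moreover have "a = (k, \<alpha> - ind S + ind S)" using a S minus_ind_plus_ind by metis
      ultimately show "a \<in> (\<Union>S. \<Union>k\<in>Poly_Mapping.keys (c S).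
        (\<lambda>m. (k, m + ind S)) ` Poly_Mapping.keys (Poly_Mapping.lookup (c S) k))" by blast
    qed
    then have fin: "finite A" by (rule finite_subset) auto
    define b where "b S = (\<Sum>(k, \<alpha>)\<in>A. strand_embed k \<alpha> (g k \<alpha>) S)" for S
    have "b \<in> chains T (Suc p) (monomial_family Q)"
    proof (rule chainsI)
      fix S assume S: "S \<subseteq> T" "card S = Suc p"
      have "\<forall>k \<alpha>. strand_embed k \<alpha> (g k \<alpha>) S \<in> monomial_family Q S"
        using chains_mem[OF strand_embed_in_chains[where Q=Q, OF g] S] by blast
      moreover have "\<exists>(k,\<alpha>)\<in>A. coeff (strand_embed k \<alpha> (g k \<alpha>) S) k' m \<noteq> 0" if "coeff (b S) k' m \<noteq> 0" for k' m
        using that unfolding b_def coeff_sum by (rule contrapos_np) (auto intro!: sum.neutral)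
      ultimately show "b S \<in> monomial_family Q S"
        unfolding monomial_family_def by fast
    next
      fix S assume "\<not> (S \<subseteq> T \<and> card S = Suc p)"
      then show "b S = 0"
        unfolding b_def using chains_zero[OF strand_embed_in_chains[where Q=Q, OF g]] by (auto intro!: sum.neutral)
    qed
    moreover have "koszul var T b S = c S" for S
    proof (rule strand_coeff_eqI)
      fix k \<alpha>
      have "strand_coeff k \<alpha> b U = (if (k, \<alpha>) \<in> A then g k \<alpha> U else 0)" for U
      proof -
        have "strand_coeff k \<alpha> b U = (\<Sum>(k', \<alpha>')\<in>A. strand_coeff k \<alpha> (strand_embed k' \<alpha>' (g k' \<alpha>')) U)"
          by (simp add: strand_coeff_def b_def coeff_sum case_prod_unfold)
        also have "\<dots> = (\<Sum>a\<in>A. if a = (k, \<alpha>) then g k \<alpha> U else 0)"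
          by (rule sum.cong) (auto simp: strand_coeff_embed[OF g] split: if_splits)
        finally show ?thesis using fin by simp
      qed
      then have "strand_coeff k \<alpha> b = (\<lambda>U. if (k, \<alpha>) \<in> A then g k \<alpha> U else 0)" by blast
      then have "strand_coeff k \<alpha> (koszul var T b) S
          = koszul (\<lambda>_. 1) T (\<lambda>U. if (k, \<alpha>) \<in> A then g k \<alpha> U else 0) S"
        by (simp add: koszul_strand_coeff[symmetric])
      also have "\<dots> = strand_coeff k \<alpha> c S"
        by (cases "(k, \<alpha>) \<in> A") (auto simp: gc A_def)
      finally show "strand_coeff k \<alpha> (koszul var T b) S = strand_coeff k \<alpha> c S" .
    qed
    ultimately show "\<exists>b\<in>chains T (Suc p) (monomial_family Q). \<forall>S. koszul var T b S = c S" by blast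
  qed
qed

section \<open>Graded free modules and monomial ideals\<close>

lemma module_ring: "module ((*) :: 'a::comm_ring_1 \<Rightarrow> 'a \<Rightarrow> 'a)"
  by unfold_locales (auto simp: algebra_simps)

text \<open>
  A monomial ideal consists of the polynomials whose monomials are all divisible by a generator,
  so it is multigraded.
\<close>

lemma span_monomials:
  fixes G :: "('n::finite \<Rightarrow>\<^sub>0 nat) set"
  shows "module.span (*) (monomial ` G)
    = {p :: ('n, 'k::comm_ring_1) mpoly. Poly_Mapping.keys p \<subseteq> up_set G}" (is "?L = ?R")
proof
  interpret R: module "(*) :: ('n, 'k) mpoly \<Rightarrow> _" by (rule module_ring)
  show "?L \<subseteq> ?R"
  proof (rule R.span_minimal)
    show "monomial ` G \<subseteq> ?R"
      by (auto simp: monomial_def intro: up_setI)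
    show "R.subspace ?R"
    proof (rule R.subspaceI)
      fix p q :: "('n, 'k) mpoly"
      assume "p \<in> ?R" "q \<in> ?R"
      then show "p + q \<in> ?R" using keys_add[of p q] by auto
    next
      fix r p :: "('n, 'k) mpoly"
      assume "p \<in> ?R"
      moreover have "a + b \<in> up_set G" if "b \<in> up_set G" for a b
        using up_set_add[OF that, of a] by (simp add: add.commute)
      ultimately show "r * p \<in> ?R"
        using keys_mult[of r p] by blast
    qed simp
  qed
  show "?R \<subseteq> ?L"
  proof
    fix p :: "('n, 'k) mpoly"
    assume "p \<in> ?R"
    then have p: "Poly_Mapping.keys p \<subseteq> up_set G" by simp
    have "p = (\<Sum>m\<in>Poly_Mapping.keys p. Poly_Mapping.single m (Poly_Mapping.lookup p m))"
      by (rule poly_mapping_eqI) (auto simp: lookup_sum lookup_single when_def in_keys_iff)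
    also have "\<dots> \<in> ?L"
    proof (rule R.span_sum)
      fix m assume "m \<in> Poly_Mapping.keys p"
      with p obtain g n where g: "g \<in> G" "m = g + n" unfolding up_set_def by blast
      have "Poly_Mapping.single m (Poly_Mapping.lookup p m)
          = Poly_Mapping.single n (Poly_Mapping.lookup p m) * monomial g"
        by (simp add: monomial_def mult_single g(2) add.commute)
      then show "Poly_Mapping.single m (Poly_Mapping.lookup p m) \<in> ?L"
        using g(1) by (auto intro: R.span_scale R.span_base)
    qed
    finally show "p \<in> ?L" .
  qed
qed

definition degree_part :: "nat list \<Rightarrow> nat \<Rightarrow> (nat \<Rightarrow>\<^sub>0 ('n::finite, 'k::comm_ring_1) mpoly)
    \<Rightarrow> (nat \<Rightarrow>\<^sub>0 ('n, 'k) mpoly)" where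
  "degree_part a e v = Poly_Mapping.mapp
     (\<lambda>k. Poly_Mapping.mapp (\<lambda>m c. c when monomial_degree m + a ! k = e)) v"

lemma coeff_degree_part: "coeff (degree_part a e v) k m = (coeff v k m when monomial_degree m + a ! k = e)"
  by (auto simp: degree_part_def lookup_mapp when_def in_keys_iff)

lemma free_module_iff: "v \<in> free_module a \<longleftrightarrow> (\<forall>k m. coeff v k m \<noteq> 0 \<longrightarrow> k < length a)"
proof -
  have "k \<in> Poly_Mapping.keys v \<longleftrightarrow> (\<exists>m. coeff v k m \<noteq> 0)" for k
    by (metis in_keys_iff lookup_zero poly_mapping_eqI)
  then show ?thesis unfolding free_module_def by auto
qed

lemma graded_piece_iff:
  "v \<in> graded_piece a e \<longleftrightarrow> (\<forall>k m. coeff v k m \<noteq> 0 \<longrightarrow> k < length a \<and> monomial_degree m + a ! k = e)"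
  by (auto simp: graded_piece_def free_module_iff in_keys_iff)

lemma degree_part_in_graded_piece:
  "v \<in> free_module a \<Longrightarrow> degree_part a e v \<in> graded_piece a e"
  by (auto simp: graded_piece_iff free_module_iff coeff_degree_part)

lemma sum_degree_parts: "\<exists>D. finite D \<and> v = (\<Sum>e\<in>D. degree_part a e v)"
proof -
  define D where "D = (\<Union>k\<in>Poly_Mapping.keys v.
    (\<lambda>m. monomial_degree m + a ! k) ` Poly_Mapping.keys (Poly_Mapping.lookup v k))"
  have "finite D" unfolding D_def by auto
  moreover have "v = (\<Sum>e\<in>D. degree_part a e v)"
  proof (rule coeff_eqI)
    fix k m
    have "coeff v k m \<noteq> 0 \<Longrightarrow> monomial_degree m + a ! k \<in> D"
      unfolding D_def by (intro UN_I[of k] imageI) (auto simp: in_keys_iff)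
    then show "coeff v k m = coeff (\<Sum>e\<in>D. degree_part a e v) k m"
      using \<open>finite D\<close> by (auto simp: coeff_sum coeff_degree_part when_def)
  qed
  ultimately show ?thesis by blast
qed

text \<open>
  The degree \<open>d\<close> strand of the Koszul complex of a graded free module, except that constants are
  left out at the empty set, where the coefficients are thus in the maximal ideal times the
  module. This truncation kills the homology in position 0 and changes nothing elsewhere.
\<close>

definition koszul_free ::
    "nat list \<Rightarrow> nat \<Rightarrow> 'n::finite set \<Rightarrow> (nat \<Rightarrow>\<^sub>0 ('n, 'k::comm_ring_1) mpoly) set" where
  "koszul_free a d = monomial_family (\<lambda>k m S. k < length a \<and> monomial_degree m + a ! k + card S = d
     \<and> 0 < monomial_degree m + card S)"

lemma koszul_free_shift_closed:
  "shift_closed (\<lambda>m S. k < length a \<and> monomial_degree m + a ! k + card (S :: 'n::finite set) = d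
     \<and> 0 < monomial_degree m + card S)"
  by (auto simp: shift_closed_def monomial_degree_add monomial_degree_single)

lemma koszul_free_stable: "koszul_stable var (koszul_free a d)"
  unfolding koszul_free_def by (rule monomial_family_stable[OF koszul_free_shift_closed])

lemma degree_minus_ind:
  assumes "S \<subseteq> Poly_Mapping.keys \<alpha>"
  shows "monomial_degree (\<alpha> - ind S) + card S = monomial_degree \<alpha>"
  by (metis assms minus_ind_plus_ind monomial_degree_add monomial_degree_ind)

text \<open>
  Each nonzero strand is a full simplex on the support of \<open>\<alpha>\<close>, and the truncation removes precisely the
  strands at \<open>\<alpha> = 0\<close>, whose simplex has no vertices.
\<close>

lemma koszul_free_acyclic:
  "acyclic_at var UNIV p (koszul_free a d :: _ \<Rightarrow> (nat \<Rightarrow>\<^sub>0 ('n::finite, 'k::comm_ring_1) mpoly) set)"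
  unfolding koszul_free_def
proof (subst monomial_family_acyclic_iff, intro allI)
  fix k and \<alpha> :: "'n \<Rightarrow>\<^sub>0 nat"
  let ?Q = "\<lambda>m (S :: 'n set). k < length a \<and> monomial_degree m + a ! k + card S = d
     \<and> 0 < monomial_degree m + card S"
  have Q: "?Q (\<alpha> - ind S) S \<longleftrightarrow> k < length a \<and> monomial_degree \<alpha> + a ! k = d \<and> 0 < monomial_degree \<alpha>"
    if "S \<subseteq> Poly_Mapping.keys \<alpha>" for S
    using degree_minus_ind[OF that] by auto
  show "acyclic_at (\<lambda>_. 1) UNIV p (strand ?Q \<alpha> :: _ \<Rightarrow> 'k set)"
  proof (cases "k < length a \<and> monomial_degree \<alpha> + a ! k = d \<and> 0 < monomial_degree \<alpha>")
    case True
    then have "Poly_Mapping.keys \<alpha> \<noteq> {}" by (auto simp: monomial_degree_zero)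
    with True Q show ?thesis
      by (intro strand_full_acyclic koszul_free_shift_closed) auto
  next
    case False
    with Q have "\<not> (S \<subseteq> Poly_Mapping.keys \<alpha> \<and> ?Q (\<alpha> - ind S) S)" for S by metis
    then have "strand ?Q \<alpha> S \<subseteq> {0 :: 'k}" for S unfolding strand_def by blast
    then show ?thesis by (intro acyclic_at_trivial) (auto simp: strand_def)
  qed
qed

section \<open>Koszul homology of a minimal resolution\<close>

context minimal_graded_free_resolution
begin

text \<open>
  The ring is viewed as the free module of rank one with shift 0, so that the augmentation becomes
  the differential out of the free module in position 0. The module \<open>syzygy 0\<close> is
  then the ideal itself and \<open>syzygy i\<close> the \<open>i\<close>-th syzygy module.
\<close>

definition target_shifts :: "nat \<Rightarrow> nat list" where
  "target_shifts i = (case i of 0 \<Rightarrow> [0] | Suc j \<Rightarrow> shifts F j)"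

definition differential :: "nat \<Rightarrow> (nat \<Rightarrow>\<^sub>0 ('n, 'k) mpoly) \<Rightarrow> (nat \<Rightarrow>\<^sub>0 ('n, 'k) mpoly)" where
  "differential i = (case i of 0 \<Rightarrow> \<lambda>v. Poly_Mapping.single 0 (aug F v) | Suc j \<Rightarrow> bdry F j)"

definition syzygy :: "nat \<Rightarrow> (nat \<Rightarrow>\<^sub>0 ('n, 'k) mpoly) set" where
  "syzygy i = differential i ` chain_module F i"

lemma differential_add: "differential i (u + v) = differential i u + differential i v"
  using module_hom.add[OF aug_linear] module_hom.add[OF bdry_linear]
  by (cases i) (auto simp: differential_def single_add)

lemma differential_scale: "differential i (vscale r v) = vscale r (differential i v)"
  using module_hom.scale[OF aug_linear] module_hom.scale[OF bdry_linear]
  by (cases i) (auto simp: differential_def vscale_conv_mult mult_single)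

lemma differential_var: "differential i (var j * v) = var j * differential i v"
  by (simp add: var_mult differential_scale)

lemma differential_0 [simp]: "differential i 0 = 0"
  using differential_add[of i 0 0] by simp

lemma differential_minus: "differential i (u - v) = differential i u - differential i v"
  using differential_add[of i "u - v" v] by simp

lemma differential_sum: "differential i (sum f A) = (\<Sum>a\<in>A. differential i (f a))"
  by (induction A rule: infinite_finite_induct) (auto simp: differential_add)

lemma syzygy_Suc: "syzygy (Suc i) = {v \<in> chain_module F i. differential i v = 0}"
proof (cases i)
  case 0
  then show ?thesis
    using exact_0 by (simp add: syzygy_def differential_def) (metis lookup_single_eq lookup_zero single_zero)
next
  case (Suc j)
  then show ?thesis using exact_Suc[of j] by (simp add: syzygy_def differential_def)
qed

lemma differential_graded:
  "v \<in> graded_piece (shifts F i) e \<Longrightarrow> differential i v \<in> graded_piece (target_shifts i) e"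
proof (cases i)
  case 0
  assume "v \<in> graded_piece (shifts F i) e"
  with 0 have "homogeneous e (aug F v)" using aug_graded by simp
  with 0 show ?thesis
    by (auto simp: differential_def target_shifts_def graded_piece_iff homogeneous_def lookup_single
        when_def in_keys_iff split: if_splits)
qed (simp add: differential_def target_shifts_def bdry_graded)

lemma syzygy_minimal: "v \<in> syzygy (Suc i) \<Longrightarrow> coeff v k 0 = 0"
  using minimal by (auto simp: syzygy_def differential_def)

text \<open>
  Take any preimage and discard its components of other degrees: they are sent to other degrees,
  so they do not contribute to \<open>z\<close>.
\<close>

lemma graded_lift:
  assumes z: "z \<in> syzygy i" "z \<in> graded_piece (target_shifts i) e"
  obtains v where "v \<in> graded_piece (shifts F i) e" "differential i v = z"
proof -
  let ?a = "shifts F i" and ?b = "target_shifts i"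
  obtain v where v: "v \<in> free_module ?a" "differential i v = z"
    using z(1) unfolding syzygy_def by blast
  obtain D where D: "finite D" "v = (\<Sum>e\<in>D. degree_part ?a e v)"
    using sum_degree_parts by blast
  let ?g = "\<lambda>e. differential i (degree_part ?a e v)"
  have g: "?g e' \<in> graded_piece ?b e'" for e'
    by (rule differential_graded[OF degree_part_in_graded_piece[OF v(1)]])
  have zs: "z = (\<Sum>e\<in>D. ?g e)"
    using D(2) v(2) differential_sum by metis
  have "?g e = z"
  proof (rule coeff_eqI)
    fix k m
    show "coeff (?g e) k m = coeff z k m"
    proof (cases "k < length ?b \<and> monomial_degree m + ?b ! k = e")
      case True
      have "coeff z k m = (\<Sum>e'\<in>D. coeff (?g e') k m)"
        by (subst zs) (simp add: coeff_sum)
      also have "\<dots> = (\<Sum>e'\<in>D. if e' = e then coeff (?g e) k m else 0)"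
        by (rule sum.cong) (use g True in \<open>auto simp: graded_piece_iff\<close>)
      also have "\<dots> = coeff (?g e) k m"
      proof (cases "e \<in> D")
        case False
        then have "degree_part ?a e v = 0"
        proof -
          have "coeff (degree_part ?a e v) k m = 0" for k m
          proof (cases "monomial_degree m + ?a ! k = e")
            case True
            have "coeff v k m = (\<Sum>e'\<in>D. coeff (degree_part ?a e' v) k m)"
              by (subst D(2)) (simp add: coeff_sum)
            also have "\<dots> = 0"
              by (rule sum.neutral) (use True \<open>e \<notin> D\<close> in \<open>auto simp: coeff_degree_part when_def\<close>)
            finally show ?thesis by (simp add: coeff_degree_part)
          qed (simp add: coeff_degree_part)
          then show ?thesis by (intro coeff_eqI) simp
        qed
        with False show ?thesis using D(1) by simp
      qed (simp add: D(1))
      finally show ?thesis by simp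
    next
      case False
      then show ?thesis using g[of e] z(2) unfolding graded_piece_iff by metis
    qed
  qed
  then show ?thesis using that degree_part_in_graded_piece[OF v(1)] by blast
qed

text \<open>
  The degree \<open>d\<close> strand of the Koszul complex of the \<open>i\<close>-th syzygy module.
\<close>

definition syzygy_family :: "nat \<Rightarrow> nat \<Rightarrow> 'n set \<Rightarrow> (nat \<Rightarrow>\<^sub>0 ('n, 'k) mpoly) set" where
  "syzygy_family i d S = {v \<in> syzygy i. \<forall>k m. coeff v k m \<noteq> 0 \<longrightarrow>
     monomial_degree m + target_shifts i ! k + card S = d}"

lemma syzygy_free: "syzygy i \<subseteq> free_module (target_shifts i)"
proof
  fix z assume "z \<in> syzygy i"
  then obtain v where v: "v \<in> free_module (shifts F i)" "z = differential i v"
    unfolding syzygy_def by blast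
  show "z \<in> free_module (target_shifts i)"
  proof (cases i)
    case 0
    then show ?thesis
      by (auto simp: v free_module_iff differential_def target_shifts_def lookup_single when_def split: if_splits)
  next
    case (Suc j)
    have "bdry F j ` chain_module F (Suc j) \<subseteq> chain_module F j"
      using exact_0 exact_Suc by (cases j) auto
    with v Suc show ?thesis by (auto simp: differential_def target_shifts_def)
  qed
qed

lemma syzygy_family_onto:
  assumes "z \<in> syzygy_family i d S"
  obtains v where "v \<in> free_module (shifts F i)" "differential i v = z"
    "\<And>k m. coeff v k m \<noteq> 0 \<Longrightarrow> monomial_degree m + shifts F i ! k + card S = d"
proof (cases "card S \<le> d")
  case True
  have "z \<in> graded_piece (target_shifts i) (d - card S)"
    using assms syzygy_free[of i] unfolding syzygy_family_def graded_piece_iff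
    by (force simp: free_module_iff)
  moreover have "z \<in> syzygy i" using assms by (simp add: syzygy_family_def)
  ultimately obtain v where v: "v \<in> graded_piece (shifts F i) (d - card S)" "differential i v = z"
    using graded_lift by blast
  show ?thesis
  proof (rule that)
    show "v \<in> free_module (shifts F i)" using v(1) by (simp add: graded_piece_def)
    show "monomial_degree m + shifts F i ! k + card S = d" if "coeff v k m \<noteq> 0" for k m
      using v(1) that True unfolding graded_piece_iff by fastforce
  qed (fact v(2))
next
  case False
  then have "coeff z k m = 0" for k m
    using assms by (force simp: syzygy_family_def)
  then have "z = 0" by (intro coeff_eqI) simp
  then show ?thesis using that[of 0] by (simp add: free_module_iff)
qed

lemma differential_family:
  assumes "v \<in> free_module (shifts F i)"
    "\<And>k m. coeff v k m \<noteq> 0 \<Longrightarrow> monomial_degree m + shifts F i ! k + card S = d"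
  shows "differential i v \<in> syzygy_family i d S"
proof (cases "card S \<le> d")
  case True
  have "v \<in> graded_piece (shifts F i) (d - card S)"
    using assms unfolding graded_piece_iff free_module_iff by force
  then have "differential i v \<in> graded_piece (target_shifts i) (d - card S)"
    by (rule differential_graded)
  with True show ?thesis
    using assms(1) unfolding syzygy_family_def graded_piece_iff syzygy_def by fastforce
next
  case False
  then have "coeff v k m = 0" for k m using assms(2)[of k m] by force
  then have "v = 0" by (intro coeff_eqI) simp
  moreover have "0 \<in> syzygy i" unfolding syzygy_def
    by (rule image_eqI[of _ _ 0]) (auto simp: free_module_iff)
  ultimately show ?thesis by (simp add: syzygy_family_def)
qed

lemma koszul_freeD:
  assumes "v \<in> koszul_free a d S"
  shows "v \<in> free_module a" "coeff v k m \<noteq> 0 \<Longrightarrow> monomial_degree m + a ! k + card S = d"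
  using assms by (auto simp: koszul_free_def monomial_family_def free_module_iff)

lemma koszul_freeI:
  assumes "v \<in> free_module a" "\<And>k m. coeff v k m \<noteq> 0 \<Longrightarrow> monomial_degree m + a ! k + card S = d"
    "S \<noteq> {} \<or> (\<forall>k. coeff v k 0 = 0)"
  shows "v \<in> koszul_free a d S"
proof -
  have "0 < monomial_degree m + card S" if "coeff v k m \<noteq> 0" for k m
    using assms(3) that by (metis add_is_0 card_0_eq finite gr0I monomial_degree_eq_0_iff)
  with assms(1,2) show ?thesis
    by (auto simp: koszul_free_def monomial_family_def free_module_iff)
qed

text \<open>
  Minimality enters here: the kernel lies in the maximal ideal times the free module, and so it
  is not affected by the truncation at the empty set.
\<close>

lemma syzygy_family_Suc:
  "syzygy_family (Suc i) d S = {v \<in> koszul_free (shifts F i) d S. differential i v = 0}"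
proof (intro set_eqI iffI)
  fix v assume v: "v \<in> syzygy_family (Suc i) d S"
  then have "v \<in> syzygy (Suc i)" by (simp add: syzygy_family_def)
  then have "v \<in> free_module (shifts F i)" "differential i v = 0" "\<And>k. coeff v k 0 = 0"
    using syzygy_minimal by (auto simp: syzygy_Suc)
  with v show "v \<in> {v \<in> koszul_free (shifts F i) d S. differential i v = 0}"
    by (auto intro!: koszul_freeI simp: syzygy_family_def target_shifts_def)
next
  fix v assume "v \<in> {v \<in> koszul_free (shifts F i) d S. differential i v = 0}"
  then show "v \<in> syzygy_family (Suc i) d S"
    using koszul_freeD[of v "shifts F i" d S] by (auto simp: syzygy_family_def target_shifts_def syzygy_Suc)
qed

lemma syzygy_family_image:
  assumes "S \<noteq> {}"
  shows "syzygy_family i d S = differential i ` koszul_free (shifts F i) d S"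
proof (intro set_eqI iffI)
  fix z assume "z \<in> syzygy_family i d S"
  then obtain v where "v \<in> free_module (shifts F i)" "differential i v = z"
    "\<And>k m. coeff v k m \<noteq> 0 \<Longrightarrow> monomial_degree m + shifts F i ! k + card S = d"
    by (rule syzygy_family_onto) blast
  then show "z \<in> differential i ` koszul_free (shifts F i) d S"
    using assms koszul_freeI by blast
next
  fix z assume "z \<in> differential i ` koszul_free (shifts F i) d S"
  then obtain v where "z = differential i v" and v: "v \<in> koszul_free (shifts F i) d S" by blast
  with differential_family[OF koszul_freeD(1)[OF v] koszul_freeD(2)[OF v]]
  show "z \<in> syzygy_family i d S" by simp
qed

lemma syzygy_family_shift:
  "acyclic_at var UNIV p (syzygy_family (Suc i) d) \<longleftrightarrow> acyclic_at var UNIV (Suc p) (syzygy_family i d)"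
  by (rule acyclic_at_dimension_shift[where f = "differential i" and E = "koszul_free (shifts F i) d"])
     (simp_all add: differential_add differential_var koszul_free_stable koszul_free_acyclic
        syzygy_family_Suc syzygy_family_image)

text \<open>
  In position 0 every chain is a cycle and the boundaries are the elements of the maximal ideal
  times the syzygy module, so acyclicity says that the syzygy module needs no generator of degree
  \<open>d\<close>. By minimality the basis elements of \<open>F\<^sub>i\<close> correspond to a minimal system of generators.
\<close>

lemma syzygy_family_acyclic_0:
  "acyclic_at var UNIV 0 (syzygy_family i d) \<longleftrightarrow> d \<notin> set (shifts F i)"
proof
  assume ac: "acyclic_at var UNIV 0 (syzygy_family i d)"
  show "d \<notin> set (shifts F i)"
  proof
    assume "d \<in> set (shifts F i)"
    then obtain k where k: "k < length (shifts F i)" "shifts F i ! k = d"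
      by (auto simp: in_set_conv_nth)
    define v :: "nat \<Rightarrow>\<^sub>0 ('n, 'k) mpoly" where "v = Poly_Mapping.single k 1"
    have cv: "coeff v k' m = (if k' = k \<and> m = 0 then 1 else 0)" for k' m
      by (simp add: v_def lookup_single when_def lookup_one)
    \<comment> \<open>If the generator \<open>\<partial> v\<close> were a combination \<open>\<partial> s\<close> with \<open>s\<close> in the maximal ideal times \<open>F\<^sub>i\<close>,
      the syzygy \<open>v - s\<close> would have a constant term.\<close>
    let ?c = "\<lambda>S :: 'n set. if S = {} then differential i v else 0"
    have "differential i v \<in> syzygy_family i d {}"
      by (rule differential_family)
         (use k in \<open>auto simp: free_module_iff cv monomial_degree_zero split: if_splits\<close>)
    then have "?c \<in> chains UNIV 0 (syzygy_family i d)"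
      by (intro chainsI) auto
    moreover have "koszul var UNIV ?c S = 0" for S by (simp add: koszul_def)
    ultimately obtain b where b: "b \<in> chains UNIV (Suc 0) (syzygy_family i d)"
      and bc: "\<And>S. koszul var UNIV b S = ?c S"
      by (rule acyclic_atD[OF ac]) blast
    have "\<exists>w. w \<in> koszul_free (shifts F i) d {j} \<and> differential i w = b {j}" for j
      using chains_mem[OF b, of "{j}"] syzygy_family_image[of "{j}" i d] by auto
    then obtain w where w: "\<And>j. w j \<in> koszul_free (shifts F i) d {j}" "\<And>j. differential i (w j) = b {j}"
      by metis
    let ?s = "\<Sum>j\<in>UNIV. var j * w j"
    have s_mem: "?s \<in> koszul_free (shifts F i) d {}"
      using w(1) by (intro koszul_stable_sum[OF koszul_free_stable] koszul_stable_act[OF koszul_free_stable]) auto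
    then have s: "?s \<in> free_module (shifts F i)" by (rule koszul_freeD)
    have s0: "coeff ?s k 0 = 0"
      using s_mem unfolding koszul_free_def monomial_family_def
      by (metis (mono_tags, lifting) add_0 card.empty less_irrefl mem_Collect_eq monomial_degree_zero)
    have "differential i ?s = differential i v"
      using bc[of "{}"] by (simp add: differential_sum differential_var w koszul_def)
    moreover have "v - ?s \<in> free_module (shifts F i)"
      using s k(1) by (auto simp: free_module_iff cv lookup_minus split: if_splits)
    ultimately have "v - ?s \<in> syzygy (Suc i)"
      by (simp add: syzygy_Suc differential_minus)
    then have "coeff (v - ?s) k 0 = 0" by (rule syzygy_minimal)
    then show False using s0 by (simp add: lookup_minus cv)
  qed
next
  assume d: "d \<notin> set (shifts F i)"
  show "acyclic_at var UNIV 0 (syzygy_family i d)"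
    unfolding acyclic_at_def
  proof (intro ballI impI)
    fix c assume c: "c \<in> chains UNIV 0 (syzygy_family i d)"
    have c0: "c S = 0" if "S \<noteq> {}" for S by (rule chains_zero[OF c]) (simp add: that)
    have "c {} \<in> syzygy_family i d {}" by (rule chains_mem[OF c]) auto
    then obtain v where v: "v \<in> free_module (shifts F i)" "differential i v = c {}"
      "\<And>k m. coeff v k m \<noteq> 0 \<Longrightarrow> monomial_degree m + shifts F i ! k + card ({} :: 'n set) = d"
      by (rule syzygy_family_onto) blast
    have "coeff v k 0 = 0" for k
    proof (rule ccontr)
      assume "coeff v k 0 \<noteq> 0"
      with v(1) v(3)[of k 0] have "k < length (shifts F i)" "shifts F i ! k = d"
        by (auto simp: free_module_iff monomial_degree_zero)
      with d show False by auto
    qed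
    with v have "v \<in> koszul_free (shifts F i) d {}" by (intro koszul_freeI) auto
    then have e: "(\<lambda>S :: 'n set. if S = {} then v else 0) \<in> chains UNIV 0 (koszul_free (shifts F i) d)"
      by (intro chainsI) auto
    obtain b where b: "b \<in> chains UNIV (Suc 0) (koszul_free (shifts F i) d)"
      and bv: "\<And>S. koszul var UNIV b S = (if S = {} then v else 0)"
      by (rule acyclic_atD[OF koszul_free_acyclic e]) (auto simp: koszul_def)
    let ?b = "\<lambda>S. differential i (b S)"
    have "?b \<in> chains UNIV (Suc 0) (syzygy_family i d)"
    proof (rule chainsI)
      fix S :: "'n set" assume S: "S \<subseteq> UNIV" "card S = Suc 0"
      then have "S \<noteq> {}" by auto
      then show "?b S \<in> syzygy_family i d S"
        using chains_mem[OF b S] by (simp add: syzygy_family_image)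
    qed (simp add: chains_zero[OF b])
    moreover have "koszul var UNIV ?b S = c S" for S
    proof (cases "S = {}")
      case True
      have "koszul var UNIV ?b {} = differential i (koszul var UNIV b {})"
        by (simp add: koszul_def differential_sum differential_var)
      with True show ?thesis by (simp add: bv v(2))
    next
      case False
      have "b (insert j S) = 0" if "j \<notin> S" for j
        by (rule chains_zero[OF b]) (use False that in auto)
      with False show ?thesis by (simp add: koszul_def c0)
    qed
    ultimately show "\<exists>b\<in>chains UNIV (Suc 0) (syzygy_family i d). \<forall>S. koszul var UNIV b S = c S"
      by blast
  qed
qed

text \<open>
  Shifting dimensions down to the ideal: the generators of \<open>F\<^sub>i\<close> in degree \<open>d\<close> are detected by the
  Koszul homology of the ideal, \<open>Tor\<^sub>i(I, K)\<^sub>d\<close>.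
\<close>

theorem generator_degree_iff:
  "d \<in> set (shifts F i) \<longleftrightarrow> \<not> acyclic_at var UNIV i (syzygy_family 0 d)"
proof -
  have "acyclic_at var UNIV p (syzygy_family i d) \<longleftrightarrow> acyclic_at var UNIV (p + i) (syzygy_family 0 d)" for p
    by (induction i arbitrary: p) (auto simp: syzygy_family_shift)
  from this[of 0] syzygy_family_acyclic_0 show ?thesis by auto
qed

text \<open>
  Only the strands of total degree \<open>d\<close> in coordinate 0 are nonzero.
\<close>

theorem ideal_strand_iff:
  assumes I: "I = module.span (*) (monomial ` G)"
  shows "acyclic_at var UNIV p (syzygy_family 0 d) \<longleftrightarrow>
    (\<forall>\<alpha>. monomial_degree \<alpha> = d \<longrightarrow>
      acyclic_at (\<lambda>_. 1) UNIV p (ideal_strand (up_set G) \<alpha> :: _ \<Rightarrow> 'k set))"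
proof -
  let ?Q = "\<lambda>k m S. k = 0 \<and> m \<in> up_set G \<and> monomial_degree m + card S = d"
  have syz: "syzygy 0 = Poly_Mapping.single 0 ` I"
    using aug_onto by (auto simp: syzygy_def differential_def)
  have "syzygy_family 0 d S = monomial_family ?Q S" for S :: "'n set"
  proof (intro set_eqI iffI)
    fix v assume "v \<in> syzygy_family 0 d S"
    then have deg: "\<And>k m. coeff v k m \<noteq> 0 \<Longrightarrow> monomial_degree m + target_shifts 0 ! k + card S = d"
      and "v \<in> syzygy 0"
      by (auto simp: syzygy_family_def)
    then obtain q where q: "v = Poly_Mapping.single 0 q" "Poly_Mapping.keys q \<subseteq> up_set G"
      unfolding syz I span_monomials by blast
    have "?Q k m S" if nz: "coeff v k m \<noteq> 0" for k m
    proof -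
      have "k = 0" "m \<in> Poly_Mapping.keys q"
        using nz by (auto simp: q(1) lookup_single when_def in_keys_iff split: if_splits)
      with deg[OF nz] q(2) show ?thesis by (auto simp: target_shifts_def)
    qed
    then show "v \<in> monomial_family ?Q S" by (simp add: monomial_family_def)
  next
    fix v :: "nat \<Rightarrow>\<^sub>0 ('n, 'k) mpoly" assume v: "v \<in> monomial_family ?Q S"
    then have "v = Poly_Mapping.single 0 (Poly_Mapping.lookup v 0)"
      by (intro coeff_eqI) (auto simp: monomial_family_def lookup_single when_def)
    moreover have "Poly_Mapping.lookup v 0 \<in> I"
      using v by (auto simp: I span_monomials monomial_family_def in_keys_iff)
    ultimately have "v \<in> syzygy 0" unfolding syz by blast
    moreover have "monomial_degree m + target_shifts 0 ! k + card S = d" if "coeff v k m \<noteq> 0" for k m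
    proof -
      have "k = 0" "monomial_degree m + card S = d"
        using v that unfolding monomial_family_def by blast+
      then show ?thesis by (simp add: target_shifts_def)
    qed
    ultimately show "v \<in> syzygy_family 0 d S"
      by (simp add: syzygy_family_def)
  qed
  then have fam: "syzygy_family 0 d = monomial_family ?Q" by blast
  have strand: "strand (?Q k) \<alpha> S =
      (if k = 0 \<and> monomial_degree \<alpha> = d then ideal_strand (up_set G) \<alpha> S else {0 :: 'k})"
    for k \<alpha> and S :: "'n set"
    using degree_minus_ind[of S \<alpha>] by (auto simp: strand_def)
  have "acyclic_at (\<lambda>_. 1) UNIV p (strand (?Q k) \<alpha> :: _ \<Rightarrow> 'k set) \<longleftrightarrow>
     (k = 0 \<and> monomial_degree \<alpha> = d \<longrightarrow> acyclic_at (\<lambda>_. 1) UNIV p (ideal_strand (up_set G) \<alpha> :: _ \<Rightarrow> 'k set))"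
    for k \<alpha>
  proof (cases "k = 0 \<and> monomial_degree \<alpha> = d")
    case True
    then have "(strand (?Q k) \<alpha> :: _ \<Rightarrow> 'k set) = ideal_strand (up_set G) \<alpha>"
      using strand by (intro ext) presburger
    with True show ?thesis by simp
  next
    case False
    have "acyclic_at (\<lambda>_. 1) UNIV p (strand (?Q k) \<alpha> :: _ \<Rightarrow> 'k set)"
      by (rule acyclic_at_trivial; subst strand) (use False in auto)
    with False show ?thesis by blast
  qed
  then show ?thesis
    unfolding fam by (subst monomial_family_acyclic_iff) auto
qed

theorem generator_degree_bound:
  assumes "I = module.span (*) (monomial ` G)" "\<And>g. g \<in> G \<Longrightarrow> monomial_degree g = 2"
    and t: "t \<in> set (shifts F (Suc i))"
  shows "\<exists>s\<in>set (shifts F i). t \<le> s + 2"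
proof (rule ccontr)
  assume *: "\<not> (\<exists>s\<in>set (shifts F i). t \<le> s + 2)"
  have "acyclic_at (\<lambda>_. 1) UNIV (Suc i) (ideal_strand (up_set G) \<alpha> :: _ \<Rightarrow> 'k set)"
    if "monomial_degree \<alpha> = t" for \<alpha>
  proof (rule quadratic_strand_acyclic[OF assms(2)])
    fix \<beta> :: "'n \<Rightarrow>\<^sub>0 nat" assume "monomial_degree \<alpha> \<le> monomial_degree \<beta> + 2"
    with that * have "monomial_degree \<beta> \<notin> set (shifts F i)" by auto
    then have "acyclic_at var UNIV i (syzygy_family 0 (monomial_degree \<beta>))"
      by (simp add: generator_degree_iff)
    then show "acyclic_at (\<lambda>_. 1) UNIV i (ideal_strand (up_set G) \<beta> :: _ \<Rightarrow> 'k set)"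
      by (simp add: ideal_strand_iff[OF assms(1)])
  qed
  then show False
    using t by (simp add: generator_degree_iff ideal_strand_iff[OF assms(1)])
qed

end

section \<open>The bound on the degrees of syzygies\<close>

lemma graded_betti_nonzero_iff: "graded_betti F i j \<noteq> 0 \<longleftrightarrow> j \<in> set (shifts F i)"
  by (auto simp: graded_betti_def in_set_conv_nth)

lemma max_syzygy_degree_eq:
  "max_syzygy_degree F i =
     (if shifts F i = [] then -\<infinity> else ereal (real (Max (set (shifts F i)))))"
  unfolding max_syzygy_degree_def graded_betti_nonzero_iff by auto

theorem corollary1p9:
  fixes I :: "('n::finite, 'k::field) mpoly set"
    and F :: "('n, 'k) free_complex"
  assumes "monomial_ideal_generated_in_degree 2 I"
    and "minimal_graded_free_resolution I F"
  shows "\<forall>i. max_syzygy_degree F (i + 1) \<le> max_syzygy_degree F i + 2"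
proof
  fix i
  obtain G where G: "\<And>g. g \<in> G \<Longrightarrow> monomial_degree g = 2" "I = module.span (*) (monomial ` G)"
    using assms(1) unfolding monomial_ideal_generated_in_degree_def by blast
  show "max_syzygy_degree F (i + 1) \<le> max_syzygy_degree F i + 2"
  proof (cases "shifts F (Suc i) = []")
    case False
    then have "Max (set (shifts F (Suc i))) \<in> set (shifts F (Suc i))" by simp
    then obtain s where s: "s \<in> set (shifts F i)" "Max (set (shifts F (Suc i))) \<le> s + 2"
      using minimal_graded_free_resolution.generator_degree_bound[OF assms(2) G(2,1)] by blast
    then have "Max (set (shifts F (Suc i))) \<le> Max (set (shifts F i)) + 2"
      by (meson List.finite_set Max_ge add_le_mono1 le_trans)
    then have "real (Max (set (shifts F (Suc i)))) \<le> real (Max (set (shifts F i))) + 2" by linarith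
    then have "ereal (real (Max (set (shifts F (Suc i))))) \<le> ereal (real (Max (set (shifts F i))) + 2)"
      by simp
    also have "\<dots> = ereal (real (Max (set (shifts F i)))) + 2"
      by (metis numeral_eq_ereal plus_ereal.simps(1))
    finally show ?thesis
      using False s(1) by (auto simp: max_syzygy_degree_eq)
  qed (simp add: max_syzygy_degree_eq)
qed

end
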